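(* Let $K\ge 2$, let $\Delta_{K-1}=\{\theta\in\mathbb{R}^K:\theta_i\ge 0,\ \sum_{i=1}^K\theta_i=1\}$, and let $\alpha\in(0,\infty)^K$. Let $H:\mathbb{R}^K\to\mathbb{R}$ satisfy conditions (A1)–(A4) below at the point $\theta^*\in\Delta_{K-1}$, let $Z=\{i:\theta^*_i=0\}$ and $m=|Z|$. Then, as $n\to\infty$, $$\mathbb{E}_{\theta\sim \mathrm{Dir}_\alpha}\big[e^{nH(\theta)}\big]\sim C_H\, e^{nH(\theta^* )}\, n^{-\frac{K-1-m}{2}}\, n^{-\sum_{i\in Z}\alpha_i}$$ for some constant $C_H\in(0,\infty)$ (independent of $n$).
   Context: $\mathrm{Dir}_\alpha$ is the Dirichlet distribution on $\Delta_{K-1}$: $(\theta_1,\dots,\theta_{K-1})$ has Lebesgue density $\frac{1}{B(\alpha)}\prod_{i=1}^{K}\theta_i^{\alpha_i-1}$ with $\theta_K=1-\sum_{i<K}\theta_i$, where $B(\alpha)=\prod_i\Gamma(\alpha_i)/\Gamma(\sum_i\alpha_i)$. Conditions: (A1) $H$ attains its maximum over $\Delta_{K-1}$ only at $\theta^*$. (A2) $H$ is continuous on $\Delta_{K-1}$ and twice continuously differentiable on an open neighborhood of $\theta^*$ in $\mathbb{R}^K$. With $Z=\{i:\theta^*_i=0\}$, there are (unique) KKT multipliers $\lambda_i\ge 0$ ($i\in Z$) and $\mu\in\mathbb{R}$ with $\nabla H(\theta^* )=-\sum_{i\in Z}\lambda_i e_i+\mu\mathbf{1}_K$, where $e_i$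 are standard basis vectors and $\mathbf{1}_K$ the all-ones vector. (A3) $\lambda_i>0$ for all $i\in Z$. (A4) $d^\top\nabla^2H(\theta^* )d<0$ for every nonzero $d\in\mathbb{R}^K$ with $\mathbf{1}_K^\top d=0$ and $d_i=0$ for all $i\in Z$. The parameter $n$ ranges over positive reals, and $f(n)\sim g(n)$ means $f(n)/g(n)\to1$. *)

theory Defs
  imports "HOL-Analysis.Analysis" "HOL-Library.Landau_Symbols"
begin

definition prob_simplex :: "(real ^ 'k) set" where
  "prob_simplex = {\<theta>. (\<forall>i. 0 \<le> \<theta> $ i) \<and> (\<Sum>i\<in>UNIV. \<theta> $ i) = 1}"

definition multi_beta :: "('k::finite \<Rightarrow> real) \<Rightarrow> real" where
  "multi_beta \<alpha> = (\<Prod>i\<in>UNIV. Gamma (\<alpha> i)) / Gamma (\<Sum>i\<in>UNIV. \<alpha> i)"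

text \<open>The coordinate k0 plays the role of the dropped "last" coordinate theta_K.
  Free coordinates: x ranging over R^{K-1} = functions on -{k0} (product Lebesgue measure).\<close>
definition free_lebesgue :: "'k::finite \<Rightarrow> ('k \<Rightarrow> real) measure" where
  "free_lebesgue k0 = PiM (- {k0}) (\<lambda>_. lborel)"

definition lift_simplex :: "'k::finite \<Rightarrow> ('k \<Rightarrow> real) \<Rightarrow> real ^ 'k" where
  "lift_simplex k0 x = (\<chi> i. if i = k0 then 1 - (\<Sum>j\<in>- {k0}. x j) else x i)"

definition free_region :: "'k::finite \<Rightarrow> ('k \<Rightarrow> real) set" where
  "free_region k0 = {x \<in> space (free_lebesgue k0).
      (\<forall>j\<in>- {k0}. 0 \<le> x j) \<and> (\<Sum>j\<in>- {k0}. x j) \<le> 1}"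

definition dirichlet_expectation ::
  "('k::finite \<Rightarrow> real) \<Rightarrow> 'k \<Rightarrow> (real ^ 'k \<Rightarrow> real) \<Rightarrow> real" where
  "dirichlet_expectation \<alpha> k0 f =
     (LINT x : free_region k0 | free_lebesgue k0.
        f (lift_simplex k0 x) *
        ((\<Prod>i\<in>UNIV. (lift_simplex k0 x $ i) powr (\<alpha> i - 1)) / multi_beta \<alpha>))"

definition C2_on_with ::
  "(real ^ 'k::finite) set \<Rightarrow> (real ^ 'k \<Rightarrow> real) \<Rightarrow> (real ^ 'k \<Rightarrow> real ^ 'k)
     \<Rightarrow> (real ^ 'k \<Rightarrow> real ^ 'k ^ 'k) \<Rightarrow> bool" where
  "C2_on_with U H G Hs \<longleftrightarrow>
     (\<forall>x\<in>U. (H has_derivative (\<lambda>h. G x \<bullet> h)) (at x)) \<and>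
     (\<forall>x\<in>U. (G has_derivative (\<lambda>h. Hs x *v h)) (at x)) \<and>
     continuous_on U Hs"

end

theory Submission
  imports Defs "HOL-Probability.Distributions" "HOL-Real_Asymp.Real_Asymp"
begin

text \<open>Laplace's method on the simplex, with two different scales. The integral does not depend on which
  coordinate is dropped, so drop one with \<open>\<theta>*\<^sub>k > 0\<close>. Substitute \<open>\<theta>\<^sub>i = u\<^sub>i / n\<close> for \<open>i \<in> Z\<close>, where
  \<open>H\<close> decreases linearly by strict complementarity, and \<open>\<theta>\<^sub>i = \<theta>*\<^sub>i + u\<^sub>i / \<surd>n\<close> for the other free
  coordinates, where \<open>H\<close> decreases quadratically. Near \<open>\<theta>*\<close> one has
  \<open>H \<theta> - H \<theta>* \<le> - c (\<Sum>i\<in>Z. \<theta>\<^sub>i + \<Sum>i\<notin>Z. (\<theta>\<^sub>i - \<theta>*\<^sub>i)\<^sup>2)\<close>, so the rescaled integrand is dominated by a product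
  of Gamma and Gaussian densities and dominated convergence gives the limit. Away from \<open>\<theta>*\<close> the
  integrand is exponentially small, because the Dirichlet kernel is integrable.\<close>

section \<open>Second-order behaviour at a strict maximiser\<close>

text \<open>The exponents come from the two scales. A coordinate in \<open>Z\<close> contributes
  \<open>1 / n\<close> from the Jacobian and \<open>n powr (1 - \<alpha> i)\<close> from the
  density, together \<open>n powr (- \<alpha> i)\<close>. Each of the K - 1 - m other free
  coordinates contributes the Jacobian \<open>1 / sqrt n\<close> alone, since its density factor
  tends to a positive constant. The obstacle is the majorant: (A4) controls the Hessian only on
  directions that vanish on \<open>Z\<close>. On other tangent directions the quadratic form may be
  positive and the mixed terms have no sign. The excess is however at most a multiple of
  \<open>norm d\<close> times the sum of the \<open>Z\<close>-coordinates of \<open>d\<close>, and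
  close to the maximiser the strictly positive multipliers absorb it. Dropping a coordinate that is
  positive at the maximiser makes every constraint active there a sign condition on a single chart
  variable. This is why the majorant factorises over the chart and why the limiting domain is a
  product of half-lines and lines.\<close>

lemma second_order_Taylor:
  fixes H :: "'a::real_inner \<Rightarrow> real" and G A :: "'a \<Rightarrow> 'a"
  assumes "open U" "x \<in> U"
    and dH: "\<And>y. y \<in> U \<Longrightarrow> (H has_derivative (\<lambda>h. G y \<bullet> h)) (at y)"
    and dG: "(G has_derivative A) (at x)"
    and "0 < e"
  shows "\<exists>\<delta>>0. \<forall>d. norm d < \<delta> \<longrightarrow>
    \<bar>H (x + d) - H x - G x \<bullet> d - (A d \<bullet> d) / 2\<bar> \<le> e * (norm d)\<^sup>2"
proof -
  obtain r where "r > 0" and r: "ball x r \<subseteq> U"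
    using assms(1,2) open_contains_ball by blast
  obtain s where "s > 0"
    and s: "\<And>y. norm (y - x) < s \<Longrightarrow> norm (G y - G x - A (y - x)) \<le> e * norm (y - x)"
    using dG \<open>0 < e\<close> unfolding has_derivative_at_alt by blast
  have linA: "linear A"
    using dG has_derivative_linear by blast
  show ?thesis
  proof (intro exI[of _ "min r s"] conjI allI impI)
    show "0 < min r s" using \<open>r > 0\<close> \<open>s > 0\<close> by simp
    fix d :: 'a assume d: "norm d < min r s"
    \<comment> \<open>Along the segment, \<open>\<phi>\<close> is \<open>H\<close> minus its linear
      and quadratic Taylor terms. Its derivative is the linearisation error of \<open>G\<close> at
      \<open>x\<close>, paired with \<open>d\<close>, so the mean value theorem needs the derivative
      of \<open>G\<close> at the single point \<open>x\<close>.\<close>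
    define \<phi> where "\<phi> t = H (x + t *\<^sub>R d) - t * (G x \<bullet> d) - t\<^sup>2 / 2 * (A d \<bullet> d)" for t
    have der: "(\<phi> has_derivative (\<lambda>h. h * ((G (x + t *\<^sub>R d) - G x - A (t *\<^sub>R d)) \<bullet> d))) (at t)"
      if t: "0 \<le> t" "t \<le> 1" for t
    proof -
      have "norm (t *\<^sub>R d) \<le> norm d"
        using t by (simp add: mult_left_le_one_le)
      hence "x + t *\<^sub>R d \<in> U"
        using d r by (force simp: dist_norm)
      hence 1: "((\<lambda>t. H (x + t *\<^sub>R d)) has_derivative (\<lambda>h. G (x + t *\<^sub>R d) \<bullet> (h *\<^sub>R d))) (at t)"
        by (intro has_derivative_compose[OF _ dH, of "\<lambda>t. x + t *\<^sub>R d" "\<lambda>h. h *\<^sub>R d"])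
           (auto intro!: derivative_eq_intros)
      show ?thesis
        unfolding \<phi>_def
        by (rule derivative_eq_intros 1 refl)+
           (auto simp: fun_eq_iff algebra_simps inner_diff_left linear_cmul[OF linA])
    qed
    have "\<bar>\<phi> 1 - \<phi> 0\<bar> \<le> e * (norm d)\<^sup>2"
    proof -
      obtain t where t: "0 < t" "t < 1"
        and eq: "\<phi> 1 - \<phi> 0 = (1 - 0) * ((G (x + t *\<^sub>R d) - G x - A (t *\<^sub>R d)) \<bullet> d)"
        using mvt_simple[of 0 1 \<phi> "\<lambda>t h. h * ((G (x + t *\<^sub>R d) - G x - A (t *\<^sub>R d)) \<bullet> d)"] der
        by (force intro: has_derivative_at_withinI)
      have le: "norm (t *\<^sub>R d) \<le> norm d"
        using t by (simp add: mult_left_le_one_le)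
      have "\<bar>\<phi> 1 - \<phi> 0\<bar> \<le> norm (G (x + t *\<^sub>R d) - G x - A (t *\<^sub>R d)) * norm d"
        unfolding eq by (simp add: Cauchy_Schwarz_ineq2)
      also have "\<dots> \<le> (e * norm (t *\<^sub>R d)) * norm d"
        using s[of "x + t *\<^sub>R d"] le d by (intro mult_right_mono) auto
      also have "\<dots> \<le> (e * norm d) * norm d"
        using le \<open>0 < e\<close> by (intro mult_right_mono mult_left_mono) auto
      finally show ?thesis by (simp add: power2_eq_square mult.assoc)
    qed
    thus "\<bar>H (x + d) - H x - G x \<bullet> d - (A d \<bullet> d) / 2\<bar> \<le> e * (norm d)\<^sup>2"
      by (simp add: \<phi>_def algebra_simps)
  qed
qed

text \<open>A compactness argument in the style of Finsler's lemma. On the compact part where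
  \<open>\<phi>\<close> is nonnegative, \<open>\<psi>\<close> has a positive minimum, so a large
  multiple of \<open>\<psi>\<close> exceeds the maximum of \<open>\<phi>\<close> there. The maximum
  over \<open>K\<close> of the then strictly negative difference supplies
  \<open>- a\<close>.\<close>

lemma compact_penalty:
  fixes \<phi> \<psi> :: "'a::topological_space \<Rightarrow> real"
  assumes K: "compact K" and cont: "continuous_on K \<phi>" "continuous_on K \<psi>"
    and nonneg: "\<And>x. x \<in> K \<Longrightarrow> 0 \<le> \<psi> x"
    and neg: "\<And>x. x \<in> K \<Longrightarrow> \<psi> x = 0 \<Longrightarrow> \<phi> x < 0"
  shows "\<exists>a>0. \<exists>t>0. \<forall>x\<in>K. \<phi> x \<le> - a + t * \<psi> x"
proof -
  define K' where "K' = K \<inter> \<phi> -` {0..}"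
  have K': "compact K'"
    using continuous_closedin_preimage[OF cont(1), of "{0..}"] K closedin_compact[OF K]
    unfolding K'_def by simp
  have "\<exists>t>0. \<forall>x\<in>K. \<phi> x - t * \<psi> x < 0"
  proof (cases "K' = {}")
    case True
    thus ?thesis using nonneg unfolding K'_def
      by (intro exI[of _ 1]) (force simp: not_le)
  next
    case False
    have "continuous_on K' \<phi>" "continuous_on K' \<psi>"
      using cont continuous_on_subset unfolding K'_def by blast+
    then obtain p q where p: "p \<in> K'" "\<And>x. x \<in> K' \<Longrightarrow> \<psi> p \<le> \<psi> x"
      and q: "q \<in> K'" "\<And>x. x \<in> K' \<Longrightarrow> \<phi> x \<le> \<phi> q"
      using continuous_attains_inf[OF K' False] continuous_attains_sup[OF K' False] by metis
    have pos: "\<psi> p > 0" "\<phi> q \<ge> 0"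
      using p(1) q(1) nonneg[of p] neg[of p] unfolding K'_def by force+
    define t where "t = (\<phi> q + 1) / \<psi> p"
    have "t > 0" using pos by (simp add: t_def)
    moreover have "\<phi> x - t * \<psi> x < 0" if "x \<in> K" for x
    proof (cases "x \<in> K'")
      case True
      have "t * \<psi> p \<le> t * \<psi> x" using p(2)[OF True] \<open>t > 0\<close> by simp
      moreover have "t * \<psi> p = \<phi> q + 1" using pos by (simp add: t_def)
      ultimately show ?thesis using q(2)[OF True] by linarith
    next
      case False
      thus ?thesis using that \<open>t > 0\<close> nonneg[OF that] unfolding K'_def
        by (smt (verit) Int_iff atLeast_iff mult_nonneg_nonneg vimage_eq)
    qed
    ultimately show ?thesis by blast
  qed
  then obtain t where t: "t > 0" "\<And>x. x \<in> K \<Longrightarrow> \<phi> x - t * \<psi> x < 0" by blast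
  show ?thesis
  proof (cases "K = {}")
    case True thus ?thesis by (auto intro: exI[of _ 1])
  next
    case False
    have "continuous_on K (\<lambda>x. \<phi> x - t * \<psi> x)"
      by (intro continuous_intros cont)
    then obtain m where m: "m \<in> K" "\<And>x. x \<in> K \<Longrightarrow> \<phi> x - t * \<psi> x \<le> \<phi> m - t * \<psi> m"
      using continuous_attains_sup[OF K False, of "\<lambda>x. \<phi> x - t * \<psi> x"] by blast
    have "- (\<phi> m - t * \<psi> m) > 0" using t(2)[OF m(1)] by simp
    moreover have "\<phi> x \<le> - (- (\<phi> m - t * \<psi> m)) + t * \<psi> x" if "x \<in> K" for x
      using m(2)[OF that] by simp
    ultimately show ?thesis using \<open>t > 0\<close> by blast
  qed
qed

text \<open>Extends (A4) from the critical subspace to all tangent directions, via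
  \<open>compact_penalty\<close> on the unit sphere. The factor \<open>norm d\<close> in the penalty
  makes both sides homogeneous of degree 2; it also makes the penalty small compared with a linear
  term in the \<open>Z\<close>-coordinates when \<open>d\<close> is small.\<close>

lemma quadratic_form_le_penalty:
  fixes A :: "real ^ 'k::finite \<Rightarrow> real ^ 'k"
  assumes linA: "linear A"
    and neg: "\<And>d. d \<noteq> 0 \<Longrightarrow> (\<Sum>i\<in>UNIV. d $ i) = 0 \<Longrightarrow> (\<And>i. i \<in> Z \<Longrightarrow> d $ i = 0) \<Longrightarrow> A d \<bullet> d < 0"
  shows "\<exists>a>0. \<exists>t>0. \<forall>d. (\<Sum>i\<in>UNIV. d $ i) = 0 \<longrightarrow>
    A d \<bullet> d \<le> - a * (norm d)\<^sup>2 + t * norm d * (\<Sum>i\<in>Z. \<bar>d $ i\<bar>)"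
proof -
  define K where "K = sphere 0 1 \<inter> {d :: real ^ 'k. (\<Sum>i\<in>UNIV. d $ i) = 0}"
  have "closed {d :: real ^ 'k. (\<Sum>i\<in>UNIV. d $ i) = 0}"
    by (intro closed_Collect_eq continuous_intros)
  hence "compact K"
    unfolding K_def by (intro compact_Int_closed) auto
  moreover have "continuous_on K (\<lambda>d. A d \<bullet> d)"
    by (intro continuous_intros linear_continuous_on linear_conv_bounded_linear[THEN iffD1] linA)
  moreover have "continuous_on K (\<lambda>d. \<Sum>i\<in>Z. \<bar>d $ i\<bar>)"
    by (intro continuous_intros)
  moreover have "A d \<bullet> d < 0" if "d \<in> K" "(\<Sum>i\<in>Z. \<bar>d $ i\<bar>) = 0" for d
    using that unfolding K_def by (intro neg) (auto simp: sum_nonneg_eq_0_iff)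
  ultimately obtain a t where "a > 0" "t > 0"
    and at: "\<And>d. d \<in> K \<Longrightarrow> A d \<bullet> d \<le> - a + t * (\<Sum>i\<in>Z. \<bar>d $ i\<bar>)"
    using compact_penalty[of K "\<lambda>d. A d \<bullet> d" "\<lambda>d. \<Sum>i\<in>Z. \<bar>d $ i\<bar>"] by (auto simp: sum_nonneg)
  show ?thesis
  proof (rule exI[of _ a], intro conjI exI[of _ t] allI impI \<open>a > 0\<close> \<open>t > 0\<close>)
    fix d :: "real ^ 'k" assume sum0: "(\<Sum>i\<in>UNIV. d $ i) = 0"
    show "A d \<bullet> d \<le> - a * (norm d)\<^sup>2 + t * norm d * (\<Sum>i\<in>Z. \<bar>d $ i\<bar>)"
    proof (cases "d = 0")
      case True thus ?thesis by (simp add: linear_0[OF linA])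
    next
      case False
      define r where "r = norm d"
      define v where "v = d /\<^sub>R r"
      have r: "r > 0" using False by (simp add: r_def)
      have dv: "d = r *\<^sub>R v" using r by (simp add: v_def)
      have "v \<in> K"
        using sum0 r False by (simp add: K_def v_def r_def sum_distrib_left[symmetric])
      from at[OF this] have "r\<^sup>2 * (A v \<bullet> v) \<le> r\<^sup>2 * (- a + t * (\<Sum>i\<in>Z. \<bar>v $ i\<bar>))"
        by (intro mult_left_mono) auto
      moreover have "A d \<bullet> d = r\<^sup>2 * (A v \<bullet> v)"
        by (simp add: dv linear_cmul[OF linA] power2_eq_square)
      moreover have "(\<Sum>i\<in>Z. \<bar>d $ i\<bar>) = r * (\<Sum>i\<in>Z. \<bar>v $ i\<bar>)"
        using r by (simp add: dv abs_mult sum_distrib_left)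
      ultimately show ?thesis
        by (simp add: r_def[symmetric] power2_eq_square algebra_simps)
    qed
  qed
qed

text \<open>Tangent directions are orthogonal to the all-ones vector, so \<open>mu\<close> drops
  out. The growth bound and the scaled limit both use the gradient in this form.\<close>

lemma KKT_gradient_inner:
  fixes d :: "real ^ 'k::finite"
  assumes "(\<Sum>i\<in>UNIV. d $ i) = 0"
  shows "((\<chi> j. mu) - (\<Sum>i\<in>Z. lam i *\<^sub>R axis i 1)) \<bullet> d = - (\<Sum>i\<in>Z. lam i * d $ i)"
proof -
  have "(\<chi> j. mu) \<bullet> d = mu * (\<Sum>i\<in>UNIV. d $ i)"
    by (simp add: inner_vec_def sum_distrib_left)
  thus ?thesis
    using assms by (simp add: inner_diff_left inner_sum_left inner_axis')
qed

text \<open>The first-order term gains at least \<open>l * s\<close>, where \<open>s\<close> is the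
  sum of the \<open>Z\<close>-coordinates. For \<open>norm d < l / t\<close> half the penalty costs
  at most \<open>l / 2 * s\<close>, so half of the linear gain survives. The curvature gains
  \<open>a / 2\<close> times the squared norm, and a Taylor error of \<open>a / 4\<close> leaves
  \<open>a / 4\<close>.\<close>

lemma local_growth:
  fixes H :: "real ^ 'k::finite \<Rightarrow> real"
  assumes U: "open U" "p \<in> U"
    and dH: "\<And>y. y \<in> U \<Longrightarrow> (H has_derivative (\<lambda>h. G y \<bullet> h)) (at y)"
    and dG: "(G has_derivative A) (at p)"
    and lam: "\<And>i. i \<in> Z \<Longrightarrow> 0 < lam i"
    and Gp: "G p = (\<chi> j. mu) - (\<Sum>i\<in>Z. lam i *\<^sub>R axis i 1)"
    and neg: "\<And>d. d \<noteq> 0 \<Longrightarrow> (\<Sum>i\<in>UNIV. d $ i) = 0 \<Longrightarrow> (\<And>i. i \<in> Z \<Longrightarrow> d $ i = 0) \<Longrightarrow> A d \<bullet> d < 0"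
  shows "\<exists>c>0. \<exists>\<delta>>0. \<forall>d. norm d < \<delta> \<longrightarrow> (\<Sum>i\<in>UNIV. d $ i) = 0 \<longrightarrow> (\<forall>i\<in>Z. 0 \<le> d $ i) \<longrightarrow>
    H (p + d) - H p \<le> - c * ((\<Sum>i\<in>Z. d $ i) + (\<Sum>i\<in>-Z. (d $ i)\<^sup>2))"
proof -
  have linA: "linear A" using dG has_derivative_linear by blast
  obtain a t where "a > 0" "t > 0"
    and at: "\<And>d. (\<Sum>i\<in>UNIV. d $ i) = 0 \<Longrightarrow>
      A d \<bullet> d \<le> - a * (norm d)\<^sup>2 + t * norm d * (\<Sum>i\<in>Z. \<bar>d $ i\<bar>)"
    using quadratic_form_le_penalty[OF linA neg] by blast
  \<comment> \<open>Inserting 1 keeps the set nonempty, which covers a maximiser in the interior of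
    the simplex.\<close>
  have "\<exists>l>0. \<forall>i\<in>Z. l \<le> lam i"
    using lam by (intro exI[of _ "Min (insert 1 (lam ` Z))"]) auto
  then obtain l where "l > 0" and l: "\<And>i. i \<in> Z \<Longrightarrow> l \<le> lam i" by blast
  obtain \<delta> where "\<delta> > 0" and \<delta>: "\<And>d. norm d < \<delta> \<Longrightarrow>
    \<bar>H (p + d) - H p - G p \<bullet> d - (A d \<bullet> d) / 2\<bar> \<le> a / 4 * (norm d)\<^sup>2"
    using second_order_Taylor[OF U dH dG, of "a/4"] \<open>a > 0\<close> by auto
  define c where "c = min (l / 2) (a / 4)"
  show ?thesis
  proof (rule exI[of _ c], intro conjI exI[of _ "min \<delta> (l / t)"] allI impI)
    show "c > 0" "min \<delta> (l / t) > 0"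
      using \<open>l > 0\<close> \<open>a > 0\<close> \<open>\<delta> > 0\<close> \<open>t > 0\<close> by (auto simp: c_def)
    fix d :: "real ^ 'k"
    assume d: "norm d < min \<delta> (l / t)" and sum0: "(\<Sum>i\<in>UNIV. d $ i) = 0"
      and dZ: "\<forall>i\<in>Z. 0 \<le> d $ i"
    define s where "s = (\<Sum>i\<in>Z. d $ i)"
    have s: "s \<ge> 0" "(\<Sum>i\<in>Z. \<bar>d $ i\<bar>) = s"
      using dZ by (auto simp: s_def intro!: sum_nonneg sum.cong)
    have "l * s \<le> (\<Sum>i\<in>Z. lam i * d $ i)"
      unfolding s_def sum_distrib_left using dZ l by (intro sum_mono mult_right_mono) auto
    moreover have "G p \<bullet> d = - (\<Sum>i\<in>Z. lam i * d $ i)"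
      unfolding Gp by (rule KKT_gradient_inner[OF sum0])
    moreover have "t * norm d * s \<le> l * s"
      using d \<open>t > 0\<close> s by (intro mult_right_mono) (auto simp: field_simps)
    moreover have "A d \<bullet> d \<le> - a * (norm d)\<^sup>2 + t * norm d * s"
      using at[OF sum0] s by simp
    ultimately have "H (p + d) - H p \<le> - (l / 2) * s - a / 4 * (norm d)\<^sup>2"
      using abs_le_D1[OF \<delta>[of d]] d by (simp add: field_simps)
    moreover have "(\<Sum>i\<in>-Z. (d $ i)\<^sup>2) \<le> (norm d)\<^sup>2"
      unfolding norm_eq_sqrt_inner inner_vec_def
      by (auto simp: power2_eq_square sum_nonneg intro!: sum_mono2)
    hence "c * (\<Sum>i\<in>-Z. (d $ i)\<^sup>2) \<le> a / 4 * (norm d)\<^sup>2"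
      using \<open>a > 0\<close> by (intro mult_mono) (auto simp: c_def sum_nonneg)
    moreover have "c * s \<le> l / 2 * s"
      using s by (intro mult_right_mono) (auto simp: c_def)
    ultimately show "H (p + d) - H p \<le> - c * ((\<Sum>i\<in>Z. d $ i) + (\<Sum>i\<in>-Z. (d $ i)\<^sup>2))"
      by (simp add: s_def[symmetric] algebra_simps)
  qed
qed

text \<open>Since \<open>G p\<close> annihilates \<open>w\<close>, the first-order term of size
  \<open>sqrt n\<close> is absent and only \<open>z\<close> is seen to first order. Writing the
  displacement as \<open>v n / sqrt n\<close> with \<open>v n\<close> tending to \<open>w\<close>,
  the quadratic term times \<open>n\<close> becomes the form at \<open>v n\<close>, and
  \<open>n\<close> times the remainder is small relative to the bounded squared norm of
  \<open>v n\<close>.\<close>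

lemma scaled_second_order_limit:
  fixes H :: "'a::euclidean_space \<Rightarrow> real" and w z :: 'a
  assumes U: "open U" "p \<in> U"
    and dH: "\<And>y. y \<in> U \<Longrightarrow> (H has_derivative (\<lambda>h. G y \<bullet> h)) (at y)"
    and dG: "(G has_derivative A) (at p)"
    and Gw: "G p \<bullet> w = 0"
  shows "((\<lambda>n. n * (H (p + (w /\<^sub>R sqrt n + z /\<^sub>R n)) - H p)) \<longlongrightarrow> G p \<bullet> z + (A w \<bullet> w) / 2) at_top"
proof -
  have linA: "linear A" using dG has_derivative_linear by blast
  define d where "d n = w /\<^sub>R sqrt n + z /\<^sub>R n" for n :: real
  define v where "v n = w + z /\<^sub>R sqrt n" for n :: real
  define R where "R d = H (p + d) - H p - G p \<bullet> d - (A d \<bullet> d) / 2" for d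
  have inv: "((\<lambda>n. inverse (sqrt n)) \<longlongrightarrow> 0) at_top"
    by (intro tendsto_inverse_0_at_top sqrt_at_top)
  have v: "(v \<longlongrightarrow> w) at_top"
    unfolding v_def by (rule tendsto_eq_intros inv refl)+ simp
  have dv: "d n = v n /\<^sub>R sqrt n" if "n > 0" for n
    using that by (simp add: d_def v_def scaleR_add_right inverse_eq_divide)
  have d: "(d \<longlongrightarrow> 0) at_top"
  proof (rule Lim_transform_eventually)
    show "((\<lambda>n. v n /\<^sub>R sqrt n) \<longlongrightarrow> 0) at_top"
      by (rule tendsto_eq_intros inv v refl)+ simp
    show "\<forall>\<^sub>F n in at_top. v n /\<^sub>R sqrt n = d n"
      using eventually_gt_at_top[of 0] by eventually_elim (simp add: dv)
  qed
  have contA: "continuous_on UNIV (\<lambda>d. A d \<bullet> d)"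
    by (intro continuous_intros linear_continuous_on linear_conv_bounded_linear[THEN iffD1] linA)
  have quad: "((\<lambda>n. (A (v n) \<bullet> v n) / 2) \<longlongrightarrow> (A w \<bullet> w) / 2) at_top"
    using continuous_on_tendsto_compose[OF contA v] by (intro tendsto_divide tendsto_const) auto
  have rem: "((\<lambda>n. n * R (d n)) \<longlongrightarrow> 0) at_top"
  proof (rule tendstoI)
    fix e :: real assume "e > 0"
    \<comment> \<open>One unit allows the squared norm of \<open>v n\<close> to exceed its limit;
      the second makes the final inequality strict.\<close>
    define e' where "e' = e / ((norm w)\<^sup>2 + 2)"
    have nw: "(norm w)\<^sup>2 + 2 > 0" by (simp add: add_nonneg_pos)
    hence "e' > 0" using \<open>e > 0\<close> by (simp add: e'_def)
    then obtain \<delta> where "\<delta> > 0" and \<delta>: "\<And>d. norm d < \<delta> \<Longrightarrow> \<bar>R d\<bar> \<le> e' * (norm d)\<^sup>2"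
      using second_order_Taylor[OF U dH dG] unfolding R_def by blast
    have "\<forall>\<^sub>F n in at_top. norm (d n) < \<delta>"
      using tendstoD[OF d \<open>\<delta> > 0\<close>] by simp
    moreover have "((\<lambda>n. (norm (v n))\<^sup>2) \<longlongrightarrow> (norm w)\<^sup>2) at_top"
      by (intro tendsto_intros v)
    hence "\<forall>\<^sub>F n in at_top. (norm (v n))\<^sup>2 < (norm w)\<^sup>2 + 1"
      by (rule order_tendstoD) simp
    ultimately show "\<forall>\<^sub>F n in at_top. dist (n * R (d n)) 0 < e"
      using eventually_gt_at_top[of 0]
    proof eventually_elim
      case (elim n)
      have "\<bar>n * R (d n)\<bar> \<le> n * (e' * (norm (d n))\<^sup>2)"
        using elim \<delta>[of "d n"] by (simp add: abs_mult)
      also have "\<dots> = e' * (norm (v n))\<^sup>2"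
        using elim(3) by (simp add: dv power_mult_distrib power_inverse)
      also have "\<dots> \<le> e' * ((norm w)\<^sup>2 + 1)"
        using elim \<open>e' > 0\<close> by (intro mult_left_mono) auto
      also have "\<dots> < e' * ((norm w)\<^sup>2 + 2)"
        using \<open>e' > 0\<close> by simp
      also have "\<dots> = e" using nw by (simp add: e'_def)
      finally show ?case by simp
    qed
  qed
  have "((\<lambda>n. G p \<bullet> z + (A (v n) \<bullet> v n) / 2 + n * R (d n)) \<longlongrightarrow> G p \<bullet> z + (A w \<bullet> w) / 2 + 0) at_top"
    by (intro tendsto_add tendsto_const quad rem)
  moreover have "\<forall>\<^sub>F n in at_top. G p \<bullet> z + (A (v n) \<bullet> v n) / 2 + n * R (d n) = n * (H (p + d n) - H p)"
    using eventually_gt_at_top[of 0]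
  proof eventually_elim
    case (elim n)
    have "n * (G p \<bullet> d n) = G p \<bullet> z"
      using elim Gw by (simp add: d_def inner_add_right)
    moreover have "n * (A (d n) \<bullet> d n) = A (v n) \<bullet> v n"
      using elim by (simp add: dv linear_cmul[OF linA] field_simps)
    ultimately show ?case
      by (simp add: R_def algebra_simps)
  qed
  ultimately show ?thesis
    unfolding d_def by (simp only: add_0_right Lim_transform_eventually)
qed

section \<open>Integration over the simplex\<close>

lemma borel_measurable_vec_lambda:
  fixes f :: "'k::finite \<Rightarrow> 'a \<Rightarrow> real"
  assumes "\<And>i. f i \<in> borel_measurable M"
  shows "(\<lambda>x. \<chi> i. f i x) \<in> borel_measurable M"
  by (subst borel_measurable_euclidean_space) (use assms in \<open>auto simp: Basis_vec_def inner_axis\<close>)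

lemma borel_measurable_vec_nth [measurable]:
  "(\<lambda>x::real ^ 'k::finite. x $ i) \<in> borel_measurable borel"
  by (intro borel_measurable_continuous_onI continuous_intros)

lemma measurable_free_lebesgue_component:
  "j \<noteq> k \<Longrightarrow> (\<lambda>x. x j) \<in> borel_measurable (free_lebesgue k)"
  unfolding free_lebesgue_def
  using measurable_component_singleton[of j "- {k}" "\<lambda>_. lborel :: real measure"] by simp

lemma measurable_lift_simplex [measurable]:
  "lift_simplex k \<in> borel_measurable (free_lebesgue k)"
  unfolding lift_simplex_def[abs_def]
proof (rule borel_measurable_vec_lambda)
  fix i show "(\<lambda>x. if i = k then 1 - (\<Sum>j\<in>- {k}. x j) else x i) \<in> borel_measurable (free_lebesgue k)"
    by (cases "i = k") (auto intro!: borel_measurable_diff borel_measurable_sum measurable_free_lebesgue_component)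
qed

lemma closed_prob_simplex: "closed (prob_simplex :: (real ^ 'k::finite) set)"
  unfolding prob_simplex_def
  by (intro closed_Collect_conj closed_Collect_all closed_Collect_le closed_Collect_eq
      continuous_on_const continuous_on_component continuous_on_sum continuous_on_id)

lemma prob_simplex_nth_le_1:
  assumes "\<theta> \<in> prob_simplex" shows "\<theta> $ i \<le> 1"
proof -
  have "\<theta> $ i \<le> (\<Sum>j\<in>UNIV. \<theta> $ j)"
    using assms by (intro member_le_sum) (auto simp: prob_simplex_def)
  thus ?thesis using assms by (simp add: prob_simplex_def)
qed

lemma compact_prob_simplex: "compact (prob_simplex :: (real ^ 'k::finite) set)"
proof -
  have "norm \<theta> \<le> 1" if "\<theta> \<in> prob_simplex" for \<theta> :: "real ^ 'k"
  proof -
    have "norm \<theta> \<le> (\<Sum>i\<in>UNIV. \<bar>\<theta> $ i\<bar>)" by (rule norm_le_l1_cart)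
    also have "\<dots> = 1" using that by (simp add: prob_simplex_def)
    finally show ?thesis .
  qed
  thus ?thesis
    using closed_prob_simplex by (auto simp: compact_eq_bounded_closed bounded_iff)
qed

lemma sum_lift_simplex: "(\<Sum>i\<in>UNIV. lift_simplex k x $ i) = 1"
proof -
  have "(\<Sum>i\<in>UNIV. lift_simplex k x $ i) = lift_simplex k x $ k + (\<Sum>i\<in>-{k}. lift_simplex k x $ i)"
    by (metis Compl_eq_Diff_UNIV finite UNIV_I sum.remove)
  also have "(\<Sum>i\<in>-{k}. lift_simplex k x $ i) = (\<Sum>i\<in>-{k}. x i)"
    by (intro sum.cong) (auto simp: lift_simplex_def)
  finally show ?thesis by (simp add: lift_simplex_def)
qed

lemma lift_simplex_mem_prob_simplex:
  assumes "x \<in> space (free_lebesgue k)"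
  shows "lift_simplex k x \<in> prob_simplex \<longleftrightarrow> x \<in> free_region k"
proof -
  have "(\<forall>i. 0 \<le> lift_simplex k x $ i) \<longleftrightarrow>
      (\<forall>j\<in>-{k}. 0 \<le> lift_simplex k x $ j) \<and> 0 \<le> lift_simplex k x $ k"
    by blast
  also have "\<dots> \<longleftrightarrow> (\<forall>j\<in>-{k}. 0 \<le> x j) \<and> (\<Sum>j\<in>-{k}. x j) \<le> 1"
    by (simp add: lift_simplex_def)
  finally show ?thesis
    using assms by (simp add: prob_simplex_def free_region_def sum_lift_simplex)
qed

text \<open>Exchanging the roles of two coordinates reflects one variable in a one-dimensional integral.\<close>

lemma nn_integral_lift_simplex_cong:
  fixes g :: "real ^ 'k::finite \<Rightarrow> ennreal"
  assumes [measurable]: "g \<in> borel_measurable borel"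
  shows "(\<integral>\<^sup>+x. g (lift_simplex k x) \<partial>free_lebesgue k) = (\<integral>\<^sup>+x. g (lift_simplex l x) \<partial>free_lebesgue l)"
proof (cases "k = l")
  case False
  interpret product_sigma_finite "\<lambda>_::'k. lborel :: real measure" by standard
  define I where "I = - {k, l}"
  have I: "- {k} = insert l I" "- {l} = insert k I" "finite I" "k \<notin> I" "l \<notin> I"
    using False by (auto simp: I_def)
  define v where "v x y z = (\<chi> i. if i = k then y else if i = l then z else x i)"
    for x :: "'k \<Rightarrow> real" and y z :: real
  have upd: "(\<Sum>j\<in>insert m I. (x(m := y)) j) = y + (\<Sum>j\<in>I. x j)" if "m \<notin> I" for m x and y :: real
    using that I(3) by (auto intro!: sum.cong)
  have vk: "lift_simplex k (x(l := y)) = v x (1 - (\<Sum>j\<in>I. x j) - y) y" for x y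
    unfolding lift_simplex_def I(1) upd[OF I(5)] using False by (simp add: v_def vec_eq_iff)
  have vl: "lift_simplex l (x(k := y)) = v x y (1 - (\<Sum>j\<in>I. x j) - y)" for x y
    unfolding lift_simplex_def I(2) upd[OF I(4)] using False by (simp add: v_def vec_eq_iff)
  have [measurable]: "(\<lambda>y. v x y (c - y)) \<in> borel_measurable borel" for x c
    unfolding v_def
  proof (rule borel_measurable_vec_lambda)
    fix i show "(\<lambda>y. if i = k then y else if i = l then c - y else x i) \<in> borel_measurable borel"
      by (cases "i = k"; cases "i = l") auto
  qed
  have Mk: "(\<lambda>x. g (lift_simplex k x)) \<in> borel_measurable (Pi\<^sub>M (insert l I) (\<lambda>_. lborel))"
    using measurable_compose[OF measurable_lift_simplex assms, of k] by (simp add: free_lebesgue_def I)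
  have Ml: "(\<lambda>x. g (lift_simplex l x)) \<in> borel_measurable (Pi\<^sub>M (insert k I) (\<lambda>_. lborel))"
    using measurable_compose[OF measurable_lift_simplex assms, of l] by (simp add: free_lebesgue_def I)
  have "(\<integral>\<^sup>+x. g (lift_simplex k x) \<partial>free_lebesgue k) =
      (\<integral>\<^sup>+x. (\<integral>\<^sup>+y. g (v x (1 - (\<Sum>j\<in>I. x j) - y) y) \<partial>lborel) \<partial>Pi\<^sub>M I (\<lambda>_. lborel))"
    unfolding free_lebesgue_def I(1) by (subst product_nn_integral_insert) (use I Mk in \<open>auto simp: vk\<close>)
  also have "\<dots> = (\<integral>\<^sup>+x. (\<integral>\<^sup>+y. g (v x y (1 - (\<Sum>j\<in>I. x j) - y)) \<partial>lborel) \<partial>Pi\<^sub>M I (\<lambda>_. lborel))"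
  proof (rule nn_integral_cong)
    fix x :: "'k \<Rightarrow> real"
    show "(\<integral>\<^sup>+y. g (v x (1 - (\<Sum>j\<in>I. x j) - y) y) \<partial>lborel) =
        (\<integral>\<^sup>+y. g (v x y (1 - (\<Sum>j\<in>I. x j) - y)) \<partial>lborel)"
      by (subst (2) nn_integral_real_affine[where c = "-1" and t = "1 - (\<Sum>j\<in>I. x j)"]) auto
  qed
  also have "\<dots> = (\<integral>\<^sup>+x. g (lift_simplex l x) \<partial>free_lebesgue l)"
    unfolding free_lebesgue_def I(2) by (subst product_nn_integral_insert) (use I Ml in \<open>auto simp: vl\<close>)
  finally show ?thesis .
qed simp

text \<open>For nonnegative functions the Bochner integral is \<open>enn2real\<close> of the
  nonnegative integral, with value 0 when the latter is infinite, so the identity transfers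
  directly.\<close>

lemma integral_lift_simplex_cong:
  fixes g :: "real ^ 'k::finite \<Rightarrow> real"
  assumes g [measurable]: "g \<in> borel_measurable borel" and nonneg: "\<And>\<theta>. 0 \<le> g \<theta>"
  shows "(\<integral>x. g (lift_simplex k x) \<partial>free_lebesgue k) = (\<integral>x. g (lift_simplex l x) \<partial>free_lebesgue l)"
proof -
  have "(\<integral>x. g (lift_simplex m x) \<partial>free_lebesgue m) =
      enn2real (\<integral>\<^sup>+x. ennreal (g (lift_simplex m x)) \<partial>free_lebesgue m)" for m
    by (rule integral_eq_nn_integral) (auto simp: nonneg)
  thus ?thesis
    using nn_integral_lift_simplex_cong[of "\<lambda>\<theta>. ennreal (g \<theta>)" k l] by simp
qed

text \<open>Diagonal change of variables, one coordinate at a time: Fubini peels off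
  \<open>j\<close> and the one-dimensional affine substitution yields the factor \<open>s j\<close>.
  The restricted lambda keeps the transformed point in the extensional function space underlying the
  product measure.\<close>

lemma nn_integral_PiM_lborel_affine:
  fixes f :: "('i \<Rightarrow> real) \<Rightarrow> ennreal"
  assumes "finite I" "\<And>i. i \<in> I \<Longrightarrow> 0 < s i"
    and "f \<in> borel_measurable (Pi\<^sub>M I (\<lambda>_. lborel))"
  shows "(\<integral>\<^sup>+x. f x \<partial>Pi\<^sub>M I (\<lambda>_. lborel)) =
    ennreal (\<Prod>i\<in>I. s i) * (\<integral>\<^sup>+x. f (\<lambda>i\<in>I. t i + s i * x i) \<partial>Pi\<^sub>M I (\<lambda>_. lborel))"
  using assms
proof (induction I arbitrary: f rule: finite_induct)
  case empty
  interpret product_sigma_finite "\<lambda>_::'i. lborel :: real measure" by standard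
  show ?case by (subst (1 2) nn_integral_empty) (simp_all add: restrict_def)
next
  case (insert j I)
  interpret product_sigma_finite "\<lambda>_::'i. lborel :: real measure" by standard
  note [measurable] = insert.prems(2)
  have sj: "s j > 0" using insert.prems by simp
  have aff [measurable]: "(\<lambda>x. \<lambda>i\<in>insert j I. t i + s i * x i) \<in>
      Pi\<^sub>M (insert j I) (\<lambda>_. lborel) \<rightarrow>\<^sub>M Pi\<^sub>M (insert j I) (\<lambda>_. lborel)"
    by (intro measurable_restrict) measurable
  \<comment> \<open>The inner integral after substitution. The induction hypothesis is applied to
    this new integrand, hence the generalisation over \<open>f\<close>.\<close>
  define F where "F x = (\<integral>\<^sup>+y. f (x(j := t j + s j * y)) \<partial>lborel)" for x
  have F: "F \<in> borel_measurable (Pi\<^sub>M I (\<lambda>_. lborel))"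
    unfolding F_def by measurable
  have upd: "(\<lambda>i\<in>I. t i + s i * x i)(j := t j + s j * y) = (\<lambda>i\<in>insert j I. t i + s i * (x(j := y)) i)" for x y
    using insert.hyps by (auto simp: fun_eq_iff)
  have "(\<integral>\<^sup>+x. f x \<partial>Pi\<^sub>M (insert j I) (\<lambda>_. lborel)) =
      (\<integral>\<^sup>+x. (\<integral>\<^sup>+y. f (x(j := y)) \<partial>lborel) \<partial>Pi\<^sub>M I (\<lambda>_. lborel))"
    by (rule product_nn_integral_insert) (use insert in auto)
  also have "\<dots> = (\<integral>\<^sup>+x. ennreal (s j) * F x \<partial>Pi\<^sub>M I (\<lambda>_. lborel))"
    unfolding F_def
    by (intro nn_integral_cong, subst nn_integral_real_affine[where c = "s j" and t = "t j"])
       (use sj in auto)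
  also have "\<dots> = ennreal (s j) * (\<integral>\<^sup>+x. F x \<partial>Pi\<^sub>M I (\<lambda>_. lborel))"
    using F by (rule nn_integral_cmult)
  also have "(\<integral>\<^sup>+x. F x \<partial>Pi\<^sub>M I (\<lambda>_. lborel)) =
      ennreal (\<Prod>i\<in>I. s i) * (\<integral>\<^sup>+x. F (\<lambda>i\<in>I. t i + s i * x i) \<partial>Pi\<^sub>M I (\<lambda>_. lborel))"
    using insert.prems F by (intro insert.IH) auto
  also have "(\<integral>\<^sup>+x. F (\<lambda>i\<in>I. t i + s i * x i) \<partial>Pi\<^sub>M I (\<lambda>_. lborel)) =
      (\<integral>\<^sup>+x. f (\<lambda>i\<in>insert j I. t i + s i * x i) \<partial>Pi\<^sub>M (insert j I) (\<lambda>_. lborel))"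
    unfolding F_def upd
    by (rule product_nn_integral_insert[symmetric]) (use insert.hyps in auto)
  also have "ennreal (s j) * (ennreal (\<Prod>i\<in>I. s i) * X) = ennreal (\<Prod>i\<in>insert j I. s i) * X" for X
    using insert.hyps sj insert.prems by (simp add: ennreal_mult prod_nonneg less_imp_le mult.assoc)
  finally show ?case .
qed

lemma integral_PiM_lborel_affine:
  fixes f :: "('i \<Rightarrow> real) \<Rightarrow> real"
  assumes "finite I" and s: "\<And>i. i \<in> I \<Longrightarrow> 0 < s i"
    and f [measurable]: "f \<in> borel_measurable (Pi\<^sub>M I (\<lambda>_. lborel))" and nonneg: "\<And>x. 0 \<le> f x"
  shows "(\<integral>x. f x \<partial>Pi\<^sub>M I (\<lambda>_. lborel)) =
    (\<Prod>i\<in>I. s i) * (\<integral>x. f (\<lambda>i\<in>I. t i + s i * x i) \<partial>Pi\<^sub>M I (\<lambda>_. lborel))"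
proof -
  have [measurable]: "(\<lambda>x. \<lambda>i\<in>I. t i + s i * x i) \<in> Pi\<^sub>M I (\<lambda>_. lborel) \<rightarrow>\<^sub>M Pi\<^sub>M I (\<lambda>_. lborel)"
    by (intro measurable_restrict) measurable
  have "(\<Prod>i\<in>I. s i) \<ge> 0" using s by (intro prod_nonneg) (auto intro: less_imp_le)
  thus ?thesis
    using nn_integral_PiM_lborel_affine[OF assms(1) s, where f = "\<lambda>x. ennreal (f x)" and t = t]
    by (subst (1 2) integral_eq_nn_integral) (auto simp: nonneg enn2real_mult)
qed

section \<open>One-dimensional majorants and integrability of the Dirichlet kernel\<close>

lemma integrable_Gamma_density:
  fixes a c :: real
  assumes "a > 0" "c > 0"
  shows "integrable lborel (\<lambda>y. indicator {0..} y * (y powr (a - 1) * exp (- c * y)))"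
proof -
  have "(\<lambda>t. complex_of_real t powr (of_real a - 1) / of_real (exp (c * t))) absolutely_integrable_on {0<..}"
    using assms by (intro absolutely_integrable_Gamma_integral) auto
  hence "integrable lebesgue (\<lambda>t. norm (indicator {0<..} t *\<^sub>R
      (complex_of_real t powr (of_real a - 1) / of_real (exp (c * t)))))"
    unfolding set_integrable_def by (rule integrable_norm)
  \<comment> \<open>Open and closed half-lines give the same function because
    \<open>0 powr b = 0\<close>.\<close>
  also have "(\<lambda>t. norm (indicator {0<..} t *\<^sub>R
      (complex_of_real t powr (of_real a - 1) / of_real (exp (c * t))))) =
      (\<lambda>y. indicator {0..} y * (y powr (a - 1) * exp (- c * y)))"
    by (auto simp: fun_eq_iff indicator_def norm_divide norm_powr_real_powr exp_minus field_simps)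
  finally show ?thesis
    by (subst (asm) integrable_completion) auto
qed

lemma integrable_Gauss_density:
  fixes c :: real
  assumes "c > 0"
  shows "integrable lborel (\<lambda>y. exp (- c * y\<^sup>2))"
proof -
  define \<sigma> where "\<sigma> = 1 / sqrt (2 * c)"
  have \<sigma>: "\<sigma>\<^sup>2 = 1 / (2 * c)" using assms by (simp add: \<sigma>_def power_divide)
  have "integrable lborel (\<lambda>y. sqrt (2 * pi * \<sigma>\<^sup>2) * normal_density 0 \<sigma> y)"
    using assms by (intro integrable_mult_right integrable_normal_density) (simp add: \<sigma>_def)
  thus ?thesis
    using assms by (simp add: normal_density_def \<sigma> mult.commute)
qed

text \<open>One bound for both signs of the exponent, so products over coordinates need not separate
  \<open>\<alpha> i < 1\<close> from \<open>\<alpha> i \<ge> 1\<close>: a nonnegative power is at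
  most 1 here, a negative one is largest at the left end \<open>a\<close>.\<close>

lemma powr_le_1_add_powr:
  fixes t :: real
  assumes "0 < a" "a \<le> t" "t \<le> 1"
  shows "t powr b \<le> 1 + a powr b"
proof (cases "b \<ge> 0")
  case True
  hence "t powr b \<le> 1" using assms by (intro powr_le1) auto
  thus ?thesis using powr_ge_zero[of a b] by linarith
next
  case False
  hence "t powr b \<le> a powr b" using assms by (intro powr_mono2') auto
  thus ?thesis by simp
qed

text \<open>The unnormalised Dirichlet density, placed on the whole of R^K instead of on a chart.
  The cut-off to the simplex is built in, so that the same function can be pulled back through every
  \<open>lift_simplex\<close> and charts can be exchanged freely.\<close>

definition dirichlet_kernel :: "('k::finite \<Rightarrow> real) \<Rightarrow> real ^ 'k \<Rightarrow> real" where
  "dirichlet_kernel \<alpha> \<theta> = indicator prob_simplex \<theta> * (\<Prod>i\<in>UNIV. (\<theta> $ i) powr (\<alpha> i - 1))"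

lemma dirichlet_kernel_nonneg: "0 \<le> dirichlet_kernel \<alpha> \<theta>"
  by (simp add: dirichlet_kernel_def prod_nonneg)

lemma sets_prob_simplex [measurable]: "(prob_simplex :: (real ^ 'k::finite) set) \<in> sets borel"
  using closed_prob_simplex by (rule borel_closed)

lemma measurable_dirichlet_kernel [measurable]: "dirichlet_kernel \<alpha> \<in> borel_measurable borel"
  unfolding dirichlet_kernel_def[abs_def] by measurable

text \<open>Some coordinate \<open>l\<close> is at least \<open>1/K\<close>; in the chart that drops \<open>l\<close>, the kernel is then
  bounded by a product of one-dimensional integrable functions.\<close>

lemma integrable_dirichlet_kernel:
  fixes \<alpha> :: "'k::finite \<Rightarrow> real"
  assumes \<alpha>: "\<And>i. 0 < \<alpha> i"
  shows "integrable (free_lebesgue k) (\<lambda>x. dirichlet_kernel \<alpha> (lift_simplex k x))"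
proof -
  interpret product_sigma_finite "\<lambda>_::'k. lborel :: real measure" by standard
  define N where "N = 1 / real CARD('k)"
  have N: "N > 0" by (simp add: N_def)
  define g where "g l \<theta> = indicator {\<theta>. N \<le> \<theta> $ l} \<theta> * dirichlet_kernel \<alpha> \<theta>"
    for l :: 'k and \<theta> :: "real ^ 'k"
  have gm [measurable]: "g l \<in> borel_measurable borel" for l
    unfolding g_def by measurable
  have g0: "g l \<theta> \<ge> 0" for l \<theta>
    by (simp add: g_def dirichlet_kernel_nonneg)
  have fin: "(\<integral>\<^sup>+x. ennreal (g l (lift_simplex l x)) \<partial>free_lebesgue l) < \<infinity>" for l
  proof -
    \<comment> \<open>On [0, 1] one has \<open>1 \<le> exp 1 * exp (- y)\<close>, so this multiple
      of the Gamma density dominates the bare power there while being integrable on the whole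
      line.\<close>
    define h where "h i y = exp 1 * (indicator {0..} y * (y powr (\<alpha> i - 1) * exp (- 1 * y)))"
      for i :: 'k and y :: real
    have "integrable (Pi\<^sub>M (-{l}) (\<lambda>_. lborel)) (\<lambda>x. \<Prod>i\<in>-{l}. h i (x i))"
      unfolding h_def
      by (intro product_integrable_prod integrable_mult_right integrable_Gamma_density) (auto simp: \<alpha>)
    hence W: "integrable (free_lebesgue l) (\<lambda>x. (1 + N powr (\<alpha> l - 1)) * (\<Prod>i\<in>-{l}. h i (x i)))"
      unfolding free_lebesgue_def by (rule integrable_mult_right)
    have le: "g l (lift_simplex l x) \<le> (1 + N powr (\<alpha> l - 1)) * (\<Prod>i\<in>-{l}. h i (x i))" for x
    proof (cases "lift_simplex l x \<in> prob_simplex \<and> N \<le> lift_simplex l x $ l")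
      case True
      let ?\<theta> = "lift_simplex l x"
      have h: "(?\<theta> $ i) powr (\<alpha> i - 1) \<le> h i (x i)" if "i \<in> -{l}" for i
      proof -
        have x: "?\<theta> $ i = x i" using that by (auto simp: lift_simplex_def)
        moreover have "0 \<le> ?\<theta> $ i" "?\<theta> $ i \<le> 1"
          using True prob_simplex_nth_le_1[of ?\<theta> i] by (auto simp: prob_simplex_def)
        hence "0 \<le> x i" "x i \<le> 1" by (simp_all add: x)
        moreover have "x i powr (\<alpha> i - 1) * 1 \<le> x i powr (\<alpha> i - 1) * (exp 1 * exp (- x i))"
          using \<open>x i \<le> 1\<close> by (intro mult_left_mono) (auto simp: exp_add[symmetric])
        ultimately show ?thesis using \<open>0 \<le> x i\<close> by (simp add: h_def mult_ac)
      qed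
      have "g l ?\<theta> = (\<Prod>i\<in>UNIV. (?\<theta> $ i) powr (\<alpha> i - 1))"
        using True by (simp add: g_def dirichlet_kernel_def)
      also have "\<dots> = (?\<theta> $ l) powr (\<alpha> l - 1) * (\<Prod>i\<in>-{l}. (?\<theta> $ i) powr (\<alpha> i - 1))"
        by (subst prod.remove[of _ l]) (auto simp: Compl_eq_Diff_UNIV)
      also have "\<dots> \<le> (1 + N powr (\<alpha> l - 1)) * (\<Prod>i\<in>-{l}. h i (x i))"
        using True N prob_simplex_nth_le_1[of ?\<theta> l] h
        by (intro mult_mono powr_le_1_add_powr prod_mono) (auto intro!: prod_nonneg)
      finally show ?thesis .
    next
      case False
      thus ?thesis by (auto simp: g_def dirichlet_kernel_def h_def intro!: mult_nonneg_nonneg prod_nonneg)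
    qed
    have "integrable (free_lebesgue l) (\<lambda>x. g l (lift_simplex l x))"
      using le g0 by (intro Bochner_Integration.integrable_bound[OF W])
        (auto intro!: AE_I2 order_trans[OF _ abs_ge_self])
    thus ?thesis using g0 by (simp add: integrable_iff_bounded)
  qed
  have le: "dirichlet_kernel \<alpha> \<theta> \<le> (\<Sum>l\<in>UNIV. g l \<theta>)" for \<theta>
  proof (cases "\<theta> \<in> prob_simplex")
    case True
    have "\<exists>l. N \<le> \<theta> $ l"
    proof (rule ccontr)
      assume "\<not> (\<exists>l. N \<le> \<theta> $ l)"
      hence "(\<Sum>l\<in>UNIV. \<theta> $ l) < (\<Sum>l\<in>(UNIV::'k set). N)"
        by (intro sum_strict_mono) (auto simp: not_le)
      thus False using True by (simp add: prob_simplex_def N_def)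
    qed
    then obtain l where "N \<le> \<theta> $ l" by blast
    hence "dirichlet_kernel \<alpha> \<theta> = g l \<theta>" by (simp add: g_def)
    also have "\<dots> \<le> (\<Sum>l\<in>UNIV. g l \<theta>)" by (intro member_le_sum) (auto simp: g0)
    finally show ?thesis .
  qed (auto simp: dirichlet_kernel_def intro!: sum_nonneg g0)
  have "(\<integral>\<^sup>+x. ennreal (dirichlet_kernel \<alpha> (lift_simplex k x)) \<partial>free_lebesgue k) \<le>
      (\<integral>\<^sup>+x. (\<Sum>l\<in>UNIV. ennreal (g l (lift_simplex k x))) \<partial>free_lebesgue k)"
    using le by (intro nn_integral_mono) (auto simp: g0 intro!: ennreal_leI)
  also have "\<dots> = (\<Sum>l\<in>UNIV. \<integral>\<^sup>+x. ennreal (g l (lift_simplex k x)) \<partial>free_lebesgue k)"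
    by (intro nn_integral_sum) measurable
  \<comment> \<open>Each summand moves to its own chart \<open>l\<close>, the one in which its bound
    was proved.\<close>
  also have "\<dots> = (\<Sum>l\<in>UNIV. \<integral>\<^sup>+x. ennreal (g l (lift_simplex l x)) \<partial>free_lebesgue l)"
    by (intro sum.cong refl nn_integral_lift_simplex_cong) measurable
  also have "\<dots> < \<infinity>" using fin by simp
  finally show ?thesis
    by (intro integrableI_nonneg) (auto simp: dirichlet_kernel_nonneg)
qed

section \<open>The expectation in an arbitrary chart, and the part away from the maximiser\<close>

text \<open>This is where the prescribed chart \<open>k0\<close> is traded for a convenient one.
  Measurability is required only after cutting off to the simplex, because (A2) gives continuity of
  \<open>H\<close> on the simplex and says nothing about points far from it.\<close>

lemma dirichlet_expectation_eq:
  fixes f :: "real ^ 'k::finite \<Rightarrow> real"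
  assumes f: "(\<lambda>\<theta>. indicator prob_simplex \<theta> * f \<theta>) \<in> borel_measurable borel" and nonneg: "\<And>\<theta>. 0 \<le> f \<theta>"
  shows "dirichlet_expectation \<alpha> k0 f =
    (\<integral>x. f (lift_simplex k x) * dirichlet_kernel \<alpha> (lift_simplex k x) \<partial>free_lebesgue k) / multi_beta \<alpha>"
proof -
  define g where "g \<theta> = f \<theta> * dirichlet_kernel \<alpha> \<theta>" for \<theta>
  have "g = (\<lambda>\<theta>. (indicator prob_simplex \<theta> * f \<theta>) * dirichlet_kernel \<alpha> \<theta>)"
    by (auto simp: g_def fun_eq_iff dirichlet_kernel_def indicator_def)
  hence "g \<in> borel_measurable borel"
    using f by simp
  hence "(\<integral>x. g (lift_simplex k0 x) \<partial>free_lebesgue k0) = (\<integral>x. g (lift_simplex k x) \<partial>free_lebesgue k)"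
    by (rule integral_lift_simplex_cong) (simp add: g_def nonneg dirichlet_kernel_nonneg)
  moreover have "dirichlet_expectation \<alpha> k0 f = (\<integral>x. g (lift_simplex k0 x) / multi_beta \<alpha> \<partial>free_lebesgue k0)"
    unfolding dirichlet_expectation_def set_lebesgue_integral_def
    by (intro Bochner_Integration.integral_cong)
       (auto simp: g_def dirichlet_kernel_def lift_simplex_mem_prob_simplex indicator_def)
  ultimately show ?thesis by (simp add: g_def)
qed

lemma indicator_mult_measurable_of_continuous_on:
  fixes H :: "real ^ 'k::finite \<Rightarrow> real"
  assumes "continuous_on prob_simplex H"
  shows "(\<lambda>\<theta>. indicator prob_simplex \<theta> * H \<theta>) \<in> borel_measurable borel"
  using borel_measurable_continuous_on_indicator[OF sets_prob_simplex assms] by simp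

lemma weighted_kernel_measurable:
  fixes H :: "real ^ 'k::finite \<Rightarrow> real"
  assumes "continuous_on prob_simplex H" and [measurable]: "A \<in> sets borel"
  shows "(\<lambda>\<theta>. dirichlet_kernel \<alpha> \<theta> * indicator A \<theta> * exp (n * (H \<theta> - h))) \<in> borel_measurable borel"
proof -
  have "(\<lambda>\<theta>. n * (indicator prob_simplex \<theta> * H \<theta> - h)) \<in> borel_measurable borel"
    by (intro borel_measurable_times[OF borel_measurable_const] borel_measurable_diff borel_measurable_const
        indicator_mult_measurable_of_continuous_on assms(1))
  note [measurable] = measurable_compose[OF this borel_measurable_exp]
  \<comment> \<open>The kernel vanishes off the simplex, so \<open>H\<close> may be replaced there
    by its measurable cut-off.\<close>
  have "(\<lambda>\<theta>. dirichlet_kernel \<alpha> \<theta> * indicator A \<theta> * exp (n * (H \<theta> - h))) =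
      (\<lambda>\<theta>. dirichlet_kernel \<alpha> \<theta> * indicator A \<theta> * exp (n * (indicator prob_simplex \<theta> * H \<theta> - h)))"
    by (auto simp: fun_eq_iff dirichlet_kernel_def indicator_def)
  also have "\<dots> \<in> borel_measurable borel" by measurable
  finally show ?thesis .
qed

text \<open>Uniqueness of the maximiser and compactness of the simplex minus the ball give a uniform
  gap \<open>e\<close>. The integral is then at most \<open>exp (- e * n)\<close> times the finite
  integral \<open>D\<close> of the kernel, which beats every power of \<open>n\<close>.\<close>

lemma far_part_limit:
  fixes H :: "real ^ 'k::finite \<Rightarrow> real"
  assumes \<alpha>: "\<And>i. 0 < \<alpha> i" and H: "continuous_on prob_simplex H"
    and max: "\<And>\<theta>. \<theta> \<in> prob_simplex \<Longrightarrow> \<theta> \<noteq> p \<Longrightarrow> H \<theta> < H p" and \<delta>: "\<delta> > 0"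
  shows "((\<lambda>n. n powr q * (\<integral>x. dirichlet_kernel \<alpha> (lift_simplex k x) * indicator (- ball p \<delta>) (lift_simplex k x) *
    exp (n * (H (lift_simplex k x) - H p)) \<partial>free_lebesgue k)) \<longlongrightarrow> 0) at_top"
proof -
  have "\<exists>e>0. \<forall>\<theta>\<in>prob_simplex - ball p \<delta>. H \<theta> - H p \<le> - e"
  proof (cases "prob_simplex - ball p \<delta> = {}")
    case True thus ?thesis by (auto intro: exI[of _ 1])
  next
    case False
    have "compact (prob_simplex - ball p \<delta>)"
      by (intro compact_diff compact_prob_simplex) simp
    moreover have "continuous_on (prob_simplex - ball p \<delta>) H"
      using H by (rule continuous_on_subset) auto
    ultimately obtain m where m: "m \<in> prob_simplex - ball p \<delta>"
      "\<And>\<theta>. \<theta> \<in> prob_simplex - ball p \<delta> \<Longrightarrow> H \<theta> \<le> H m"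
      using continuous_attains_sup[OF _ False] by blast
    have "m \<noteq> p" using m(1) \<delta> by auto
    thus ?thesis using m max[of m] by (intro exI[of _ "H p - H m"]) auto
  qed
  then obtain e where "e > 0" and e: "\<And>\<theta>. \<theta> \<in> prob_simplex \<Longrightarrow> \<theta> \<notin> ball p \<delta> \<Longrightarrow> H \<theta> - H p \<le> - e" by blast
  define D where "D = (\<integral>x. dirichlet_kernel \<alpha> (lift_simplex k x) \<partial>free_lebesgue k)"
  define I where "I n = (\<integral>x. dirichlet_kernel \<alpha> (lift_simplex k x) * indicator (- ball p \<delta>) (lift_simplex k x) *
    exp (n * (H (lift_simplex k x) - H p)) \<partial>free_lebesgue k)" for n
  have I0: "I n \<ge> 0" for n
    unfolding I_def by (intro integral_nonneg_AE) (simp add: dirichlet_kernel_nonneg)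
  have I_le: "I n \<le> exp (- e * n) * D" if n: "n > 0" for n
  proof -
    have "I n \<le> (\<integral>x. exp (- e * n) * dirichlet_kernel \<alpha> (lift_simplex k x) \<partial>free_lebesgue k)"
      unfolding I_def
    proof (rule integral_mono')
      show "integrable (free_lebesgue k) (\<lambda>x. exp (- e * n) * dirichlet_kernel \<alpha> (lift_simplex k x))"
        by (intro integrable_mult_right integrable_dirichlet_kernel \<alpha>)
      fix x
      let ?\<theta> = "lift_simplex k x"
      show "dirichlet_kernel \<alpha> ?\<theta> * indicator (- ball p \<delta>) ?\<theta> * exp (n * (H ?\<theta> - H p)) \<le>
        exp (- e * n) * dirichlet_kernel \<alpha> ?\<theta>"
      proof (cases "?\<theta> \<in> prob_simplex \<and> ?\<theta> \<notin> ball p \<delta>")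
        case True
        hence "n * (H ?\<theta> - H p) \<le> n * (- e)" using n e by (intro mult_left_mono) auto
        hence "dirichlet_kernel \<alpha> ?\<theta> * exp (n * (H ?\<theta> - H p)) \<le> dirichlet_kernel \<alpha> ?\<theta> * exp (- e * n)"
          by (intro mult_left_mono dirichlet_kernel_nonneg) (simp add: mult.commute)
        thus ?thesis using True by (simp add: mult.commute)
      qed (auto simp: dirichlet_kernel_def prod_nonneg)
    qed (simp add: dirichlet_kernel_nonneg)
    thus ?thesis by (simp add: D_def)
  qed
  have "((\<lambda>n. n powr q * exp (- e * n)) \<longlongrightarrow> 0) at_top"
    using \<open>e > 0\<close> by real_asymp
  hence "((\<lambda>n. n powr q * exp (- e * n) * D) \<longlongrightarrow> 0 * D) at_top"
    by (intro tendsto_mult tendsto_const)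
  hence lim: "((\<lambda>n. n powr q * exp (- e * n) * D) \<longlongrightarrow> 0) at_top" by simp
  have "((\<lambda>n. n powr q * I n) \<longlongrightarrow> 0) at_top"
  proof (rule tendsto_sandwich[OF _ _ tendsto_const lim])
    show "\<forall>\<^sub>F n in at_top. 0 \<le> n powr q * I n" by (simp add: I0)
    show "\<forall>\<^sub>F n in at_top. n powr q * I n \<le> n powr q * exp (- e * n) * D"
      using eventually_gt_at_top[of 0]
    proof eventually_elim
      case (elim n)
      have "n powr q * I n \<le> n powr q * (exp (- e * n) * D)"
        by (intro mult_left_mono I_le elim) simp
      thus ?case by (simp only: mult.assoc)
    qed
  qed
  thus ?thesis unfolding I_def .
qed

section \<open>The contribution of a neighbourhood of the maximiser\<close>

text \<open>The hypotheses isolate what dominated convergence uses: \<open>growth\<close> for the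
  majorant, \<open>\<delta>_half\<close> to keep the density factors outside \<open>Z\<close>
  bounded, and \<open>lim\<close> for the pointwise limit. The smoothness of \<open>H\<close> enters
  through \<open>c\<close>, \<open>lam\<close> and \<open>Q\<close> alone. The constant is the
  integral of the limit function \<open>L\<close> below.\<close>

lemma near_part_limit:
  fixes H :: "real ^ 'k::finite \<Rightarrow> real" and Q :: "real ^ 'k \<Rightarrow> real"
  defines "near \<equiv> \<lambda>\<alpha> p \<delta> n \<theta>. dirichlet_kernel \<alpha> \<theta> * indicator (ball p \<delta>) \<theta> * exp (n * (H \<theta> - H p))"
  assumes \<alpha>: "\<And>i. 0 < \<alpha> i"
    and p: "p \<in> prob_simplex" and Z: "Z = {i. p $ i = 0}" and k: "p $ k \<noteq> 0"
    and H: "continuous_on prob_simplex H"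
    and c: "c > 0" and \<delta>: "\<delta> > 0" and \<delta>_half: "\<And>i. i \<notin> Z \<Longrightarrow> \<delta> \<le> p $ i / 2"
    and growth: "\<And>\<theta>. \<theta> \<in> prob_simplex \<Longrightarrow> \<theta> \<in> ball p \<delta> \<Longrightarrow>
      H \<theta> - H p \<le> - c * ((\<Sum>i\<in>Z. \<theta> $ i) + (\<Sum>i\<in>-Z. (\<theta> $ i - p $ i)\<^sup>2))"
    and Q: "Q \<in> borel_measurable borel"
    and lim: "\<And>w z. (\<Sum>i\<in>UNIV. w $ i) = 0 \<Longrightarrow> (\<And>i. i \<in> Z \<Longrightarrow> w $ i = 0) \<Longrightarrow> (\<Sum>i\<in>UNIV. z $ i) = 0 \<Longrightarrow>
      ((\<lambda>n. n * (H (p + (w /\<^sub>R sqrt n + z /\<^sub>R n)) - H p)) \<longlongrightarrow> - (\<Sum>i\<in>Z. lam i * z $ i) + Q w) at_top"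
  shows "\<exists>C>0. ((\<lambda>n. n powr ((real CARD('k) - 1 - real (card Z)) / 2 + (\<Sum>i\<in>Z. \<alpha> i)) *
    (\<integral>x. near \<alpha> p \<delta> n (lift_simplex k x) \<partial>free_lebesgue k)) \<longlongrightarrow> C) at_top"
proof -
  interpret product_sigma_finite "\<lambda>_::'k. lborel :: real measure" by standard
  \<comment> \<open>The free coordinates that scale like \<open>1 / sqrt n\<close>. As
    \<open>k\<close> lies outside \<open>Z\<close>, all of \<open>Z\<close> consists of chart
    variables and \<open>F\<close> has K - 1 - m elements.\<close>
  define F where "F = - Z - {k}"
  have kZ: "k \<notin> Z" using k Z by simp
  have J: "- {k} = Z \<union> F" "Z \<inter> F = {}" and cZ: "- Z = insert k F" "k \<notin> F"
    using kZ by (auto simp: F_def)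
  have sumJ: "(\<Sum>i\<in>-{k}. f i) = (\<Sum>i\<in>Z. f i) + (\<Sum>i\<in>F. f i)" for f :: "'k \<Rightarrow> real"
    unfolding J(1) using J(2) by (intro sum.union_disjoint) auto
  have prodJ: "(\<Prod>i\<in>-{k}. f i) = (\<Prod>i\<in>Z. f i) * (\<Prod>i\<in>F. f i)" for f :: "'k \<Rightarrow> real"
    unfolding J(1) using J(2) by (intro prod.union_disjoint) auto
  have sumU: "(\<Sum>i\<in>UNIV. f i) = f k + ((\<Sum>i\<in>Z. f i) + (\<Sum>i\<in>F. f i))" for f :: "'k \<Rightarrow> real"
    by (subst sum.remove[of _ k]) (auto simp: sumJ[symmetric] Compl_eq_Diff_UNIV)
  have prodU: "(\<Prod>i\<in>UNIV. f i) = (\<Prod>i\<in>Z. f i) * (\<Prod>i\<in>-Z. f i)" for f :: "'k \<Rightarrow> real"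
    using prod.union_disjoint[of Z "-Z" f] by simp
  have cardF: "real (card F) = real CARD('k) - 1 - real (card Z)"
    using sumU[of "\<lambda>_. 1"] by simp
  have ppos: "p $ i > 0" if "i \<notin> Z" for i
    using that p Z by (auto simp: prob_simplex_def less_le)

  define s where "s n i = (if i \<in> Z then 1 / n else 1 / sqrt n)" for n :: real and i
  \<comment> \<open>The displacement splits by scale: \<open>w u\<close> moves at speed
    \<open>1 / sqrt n\<close> and \<open>z u\<close> at speed \<open>1 / n\<close>. In each,
    coordinate \<open>k\<close> compensates the others, so both are tangent to the simplex as
    \<open>lim\<close> demands.\<close>
  define w where "w u = (\<chi> i. if i = k then - (\<Sum>j\<in>F. u j) else if i \<in> Z then 0 else u i)" for u :: "'k \<Rightarrow> real"
  define z where "z u = (\<chi> i. if i = k then - (\<Sum>j\<in>Z. u j) else if i \<in> Z then u i else 0)" for u :: "'k \<Rightarrow> real"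
  define \<Theta> where "\<Theta> n u = lift_simplex k (\<lambda>i\<in>-{k}. p $ i + s n i * u i)" for n u
  have sum_w: "(\<Sum>i\<in>UNIV. w u $ i) = 0" for u
  proof -
    have "(\<Sum>i\<in>Z. w u $ i) = 0" "(\<Sum>i\<in>F. w u $ i) = (\<Sum>i\<in>F. u i)"
      using kZ by (auto simp: w_def F_def intro!: sum.neutral sum.cong)
    thus ?thesis unfolding sumU by (simp add: w_def)
  qed
  have sum_z: "(\<Sum>i\<in>UNIV. z u $ i) = 0" for u
  proof -
    have "(\<Sum>i\<in>F. z u $ i) = 0" "(\<Sum>i\<in>Z. z u $ i) = (\<Sum>i\<in>Z. u i)"
      using kZ by (auto simp: z_def F_def intro!: sum.neutral sum.cong)
    thus ?thesis unfolding sumU by (simp add: z_def)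
  qed
  have \<Theta>_nth: "\<Theta> n u $ i = p $ i + s n i * u i" if "i \<noteq> k" for n u i
    using that by (simp add: \<Theta>_def lift_simplex_def)
  have \<Theta>_Z: "\<Theta> n u $ i = u i / n" if "i \<in> Z" for n u i
    using that kZ \<Theta>_nth[of i n u] Z by (auto simp: s_def)
  have \<Theta>_eq: "\<Theta> n u = p + (w u /\<^sub>R sqrt n + z u /\<^sub>R n)" for n u
  proof -
    define D where "D = p + (w u /\<^sub>R sqrt n + z u /\<^sub>R n)"
    have eq: "\<Theta> n u $ i = D $ i" if "i \<noteq> k" for i
      using that by (simp add: \<Theta>_nth D_def s_def w_def z_def divide_inverse)
    have "(\<Sum>i\<in>UNIV. D $ i) = 1"
      using p sum_w[of u] sum_z[of u]
      by (simp add: D_def sum.distrib sum_distrib_left[symmetric] prob_simplex_def)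
    moreover have "(\<Sum>i\<in>UNIV. \<Theta> n u $ i) = 1" by (simp add: \<Theta>_def sum_lift_simplex)
    moreover have "(\<Sum>i\<in>Z. \<Theta> n u $ i) = (\<Sum>i\<in>Z. D $ i)" "(\<Sum>i\<in>F. \<Theta> n u $ i) = (\<Sum>i\<in>F. D $ i)"
      using kZ by (auto simp: F_def intro!: sum.cong eq)
    ultimately have "\<Theta> n u $ k = D $ k" unfolding sumU by linarith
    thus ?thesis using eq unfolding D_def[symmetric] vec_eq_iff by metis
  qed
  have \<Theta>_lim: "((\<lambda>n. \<Theta> n u) \<longlongrightarrow> p) at_top" for u
  proof -
    have "((\<lambda>n. p + (inverse (sqrt n) *\<^sub>R w u + inverse n *\<^sub>R z u)) \<longlongrightarrow>
        p + (0 *\<^sub>R w u + 0 *\<^sub>R z u)) at_top"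
      by (intro tendsto_add tendsto_scaleR tendsto_const tendsto_inverse_0_at_top sqrt_at_top filterlim_ident)
    thus ?thesis unfolding \<Theta>_eq by simp
  qed
  have \<Theta>_meas [measurable]: "\<Theta> n \<in> borel_measurable (free_lebesgue k)" for n
  proof -
    have "(\<lambda>u. \<lambda>i\<in>-{k}. p $ i + s n i * u i) \<in> free_lebesgue k \<rightarrow>\<^sub>M free_lebesgue k"
      unfolding free_lebesgue_def by (intro measurable_restrict) measurable
    thus ?thesis unfolding \<Theta>_def[abs_def] by (rule measurable_compose) measurable
  qed
  have near_meas [measurable]: "near \<alpha> p \<delta> n \<in> borel_measurable borel" for n
    unfolding near_def by (intro weighted_kernel_measurable H) simp
  have near_nonneg: "near \<alpha> p \<delta> n \<theta> \<ge> 0" for n \<theta>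
    by (simp add: near_def dirichlet_kernel_nonneg)

  \<comment> \<open>This power of \<open>n\<close> turns
    \<open>(u i / n) powr (\<alpha> i - 1)\<close> into \<open>u i powr (\<alpha> i - 1)\<close> for
    every \<open>i\<close> in \<open>Z\<close>. What remains of the normalisation is cancelled by
    the Jacobian at the end.\<close>
  define S where "S n u = n powr (\<Sum>i\<in>Z. \<alpha> i - 1) * near \<alpha> p \<delta> n (\<Theta> n u)" for n u
  have S_eq: "S n u = (\<Prod>i\<in>Z. u i powr (\<alpha> i - 1)) * (\<Prod>i\<in>-Z. \<Theta> n u $ i powr (\<alpha> i - 1)) *
      exp (n * (H (\<Theta> n u) - H p))"
    if "n > 0" "\<Theta> n u \<in> prob_simplex" "\<Theta> n u \<in> ball p \<delta>" for n u
  proof -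
    have nonneg: "u i \<ge> 0" if "i \<in> Z" for i
    proof -
      have "u i / n \<ge> 0"
        using \<open>\<Theta> n u \<in> prob_simplex\<close> \<Theta>_Z[OF that, of n u] by (metis (mono_tags) prob_simplex_def mem_Collect_eq)
      thus ?thesis using \<open>n > 0\<close> by (simp add: zero_le_divide_iff)
    qed
    have "n powr (\<Sum>i\<in>Z. \<alpha> i - 1) * (\<Prod>i\<in>Z. \<Theta> n u $ i powr (\<alpha> i - 1)) =
        (\<Prod>i\<in>Z. n powr (\<alpha> i - 1) * (u i / n) powr (\<alpha> i - 1))"
      using \<open>n > 0\<close> by (simp add: powr_sum prod.distrib \<Theta>_Z)
    also have "\<dots> = (\<Prod>i\<in>Z. u i powr (\<alpha> i - 1))"
      using \<open>n > 0\<close> nonneg by (intro prod.cong refl) (simp add: powr_divide)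
    finally show ?thesis
      using that by (simp add: S_def near_def dirichlet_kernel_def prodU mult.assoc[symmetric])
  qed
  have S_0: "S n u = 0" if "\<not> (\<Theta> n u \<in> prob_simplex \<and> \<Theta> n u \<in> ball p \<delta>)" for n u
    using that by (auto simp: S_def near_def dirichlet_kernel_def)
  have S_nonneg: "S n u \<ge> 0" for n u
    by (simp add: S_def near_nonneg)

  \<comment> \<open>Inside the ball the coordinates outside \<open>Z\<close>, \<open>k\<close> among
    them, lie between \<open>p $ i / 2\<close> and 1, so \<open>powr_le_1_add_powr\<close> bounds
    their density factors uniformly in \<open>n\<close>.\<close>
  define B where "B = (\<Prod>i\<in>-Z. 1 + (p $ i / 2) powr (\<alpha> i - 1))"
  define h where "h i y = (if i \<in> Z then indicator {0..} y * (y powr (\<alpha> i - 1) * exp (- c * y)) else exp (- c * y\<^sup>2))"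
    for i and y :: real
  define W where "W u = B * (\<Prod>i\<in>-{k}. h i (u i))" for u
  have W_int: "integrable (free_lebesgue k) W"
    unfolding W_def[abs_def] free_lebesgue_def
  proof (intro integrable_mult_right product_integrable_prod)
    fix i show "integrable lborel (h i)"
      unfolding h_def[abs_def]
      using integrable_Gamma_density[OF \<alpha> c, of i] integrable_Gauss_density[OF c] by (cases "i \<in> Z") simp_all
  qed simp
  have W_nonneg: "W u \<ge> 0" for u
    unfolding W_def B_def
    by (intro mult_nonneg_nonneg prod_nonneg ballI) (auto simp: h_def add_nonneg_nonneg)
  have S_le_W: "S n u \<le> W u" if n: "n > 0" for n u
  proof (cases "\<Theta> n u \<in> prob_simplex \<and> \<Theta> n u \<in> ball p \<delta>")
    case True
    have nonneg: "u i \<ge> 0" if "i \<in> Z" for i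
    proof -
      have "u i / n \<ge> 0"
        using True \<Theta>_Z[OF that, of n u] by (metis (mono_tags) prob_simplex_def mem_Collect_eq)
      thus ?thesis using \<open>n > 0\<close> by (simp add: zero_le_divide_iff)
    qed
    have "(\<Prod>i\<in>-Z. \<Theta> n u $ i powr (\<alpha> i - 1)) \<le> B"
      unfolding B_def
    proof (intro prod_mono conjI powr_le_1_add_powr)
      fix i assume i: "i \<in> - Z"
      have "\<bar>(\<Theta> n u - p) $ i\<bar> \<le> norm (\<Theta> n u - p)" by (rule component_le_norm_cart)
      also have "\<dots> < \<delta>" using True by (simp add: dist_norm norm_minus_commute)
      also have "\<dots> \<le> p $ i / 2" using i by (intro \<delta>_half) simp
      finally show "p $ i / 2 \<le> \<Theta> n u $ i" by (simp only: vector_minus_component)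
      show "0 < p $ i / 2" using ppos i by simp
      show "\<Theta> n u $ i \<le> 1" using True prob_simplex_nth_le_1 by blast
    qed simp
    moreover have "n * (H (\<Theta> n u) - H p) \<le> (\<Sum>i\<in>Z. - c * u i) + (\<Sum>i\<in>F. - c * (u i)\<^sup>2)"
    proof -
      have 1: "n * (\<Sum>i\<in>Z. \<Theta> n u $ i) = (\<Sum>i\<in>Z. u i)"
        using n by (simp add: sum_distrib_left \<Theta>_Z)
      have "(\<Sum>i\<in>F. (u i)\<^sup>2) = n * (\<Sum>i\<in>F. (\<Theta> n u $ i - p $ i)\<^sup>2)"
        unfolding sum_distrib_left using n cZ
        by (intro sum.cong) (auto simp: \<Theta>_nth s_def F_def power_divide)
      \<comment> \<open>The square at \<open>k\<close> is discarded: that coordinate depends on all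
        chart variables, and without it the majorant is a product.\<close>
      also have "\<dots> \<le> n * (\<Sum>i\<in>-Z. (\<Theta> n u $ i - p $ i)\<^sup>2)"
        using n cZ by (intro mult_left_mono sum_mono2) auto
      finally have 2: "(\<Sum>i\<in>F. (u i)\<^sup>2) \<le> n * (\<Sum>i\<in>-Z. (\<Theta> n u $ i - p $ i)\<^sup>2)" .
      have "n * (H (\<Theta> n u) - H p) \<le> n * (- c * ((\<Sum>i\<in>Z. \<Theta> n u $ i) + (\<Sum>i\<in>-Z. (\<Theta> n u $ i - p $ i)\<^sup>2)))"
        using True n by (intro mult_left_mono growth) auto
      also have "\<dots> = - c * (n * (\<Sum>i\<in>Z. \<Theta> n u $ i) + n * (\<Sum>i\<in>-Z. (\<Theta> n u $ i - p $ i)\<^sup>2))"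
        by (simp add: algebra_simps)
      also have "\<dots> \<le> - c * ((\<Sum>i\<in>Z. u i) + (\<Sum>i\<in>F. (u i)\<^sup>2))"
        using c 2 unfolding 1 by simp
      finally show ?thesis by (simp add: sum_distrib_left algebra_simps sum_negf)
    qed
    hence "exp (n * (H (\<Theta> n u) - H p)) \<le> (\<Prod>i\<in>Z. exp (- c * u i)) * (\<Prod>i\<in>F. exp (- c * (u i)\<^sup>2))"
      by (simp only: exp_sum[symmetric] exp_add[symmetric] finite exp_le_cancel_iff)
    ultimately have "S n u \<le> (\<Prod>i\<in>Z. u i powr (\<alpha> i - 1)) * B *
        ((\<Prod>i\<in>Z. exp (- c * u i)) * (\<Prod>i\<in>F. exp (- c * (u i)\<^sup>2)))"
      unfolding S_eq[OF n conjunct1[OF True] conjunct2[OF True]]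
      by (intro mult_mono mult_left_mono) (auto intro!: prod_nonneg mult_nonneg_nonneg add_nonneg_nonneg simp: B_def)
    also have "\<dots> = W u"
    proof -
      have "(\<Prod>i\<in>Z. h i (u i)) = (\<Prod>i\<in>Z. u i powr (\<alpha> i - 1)) * (\<Prod>i\<in>Z. exp (- c * u i))"
        unfolding prod.distrib[symmetric] using nonneg by (intro prod.cong) (auto simp: h_def)
      moreover have "(\<Prod>i\<in>F. h i (u i)) = (\<Prod>i\<in>F. exp (- c * (u i)\<^sup>2))"
        by (intro prod.cong) (auto simp: h_def F_def)
      ultimately show ?thesis by (simp add: W_def prodJ mult_ac)
    qed
    finally show ?thesis .
  qed (simp add: S_0 W_nonneg)

  \<comment> \<open>The rescaled domain fills the half-lines \<open>u i \<ge> 0\<close> for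
    \<open>i\<close> in \<open>Z\<close> and is unrestricted in the \<open>F\<close>-coordinates. In
    the application \<open>Q (w u)\<close> is half the Hessian form on the critical subspace,
    expressed in these coordinates.\<close>
  define L where "L u = (\<Prod>i\<in>Z. indicator {0..} (u i) * u i powr (\<alpha> i - 1)) * (\<Prod>i\<in>-Z. p $ i powr (\<alpha> i - 1)) *
      exp (- (\<Sum>i\<in>Z. lam i * u i) + Q (w u))" for u
  have S_lim: "((\<lambda>n. S n u) \<longlongrightarrow> L u) at_top" for u
  proof (cases "\<forall>i\<in>Z. u i \<ge> 0")
    case False
    then obtain i where i: "i \<in> Z" "u i < 0" by force
    have "L u = 0" using i by (auto simp: L_def intro!: prod_zero bexI[of _ i])
    moreover have "\<forall>\<^sub>F n in at_top. 0 = S n u"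
      using eventually_gt_at_top[of 0]
    proof eventually_elim
      case (elim n)
      have "\<Theta> n u $ i < 0" using i elim by (simp add: \<Theta>_Z divide_neg_pos)
      hence "\<Theta> n u \<notin> prob_simplex" by (auto simp: prob_simplex_def not_le)
      thus ?case by (simp add: S_0)
    qed
    ultimately show ?thesis by (simp add: Lim_transform_eventually[OF tendsto_const])
  next
    case True
    \<comment> \<open>Outside \<open>Z\<close>, in particular at \<open>k\<close>, the components
      tend to positive limits, so their constraints are eventually inactive and the signs on
      \<open>Z\<close> alone decide membership in the simplex.\<close>
    have "\<forall>\<^sub>F n in at_top. \<forall>i\<in>-Z. 0 < \<Theta> n u $ i"
      by (intro eventually_ball_finite ballI order_tendstoD(1)[OF tendsto_vec_nth[OF \<Theta>_lim]])
         (auto simp: ppos)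
    moreover have "\<forall>\<^sub>F n in at_top. \<Theta> n u \<in> ball p \<delta>"
      using tendstoD[OF \<Theta>_lim \<delta>, of u] by (simp add: dist_commute)
    ultimately have ev: "\<forall>\<^sub>F n in at_top. (\<Prod>i\<in>Z. u i powr (\<alpha> i - 1)) * (\<Prod>i\<in>-Z. \<Theta> n u $ i powr (\<alpha> i - 1)) *
      exp (n * (H (\<Theta> n u) - H p)) = S n u"
      using eventually_gt_at_top[of 0]
    proof eventually_elim
      case (elim n)
      have "0 \<le> \<Theta> n u $ i" for i
        using True elim by (cases "i \<in> Z") (auto simp: \<Theta>_Z intro: less_imp_le)
      hence "\<Theta> n u \<in> prob_simplex"
        by (simp add: prob_simplex_def \<Theta>_def sum_lift_simplex)
      thus ?case using elim by (simp add: S_eq)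
    qed
    have "((\<lambda>n. n * (H (\<Theta> n u) - H p)) \<longlongrightarrow> - (\<Sum>i\<in>Z. lam i * z u $ i) + Q (w u)) at_top"
      unfolding \<Theta>_eq using kZ by (intro lim sum_w sum_z) (auto simp: w_def)
    moreover have "(\<Sum>i\<in>Z. lam i * z u $ i) = (\<Sum>i\<in>Z. lam i * u i)"
      using kZ by (intro sum.cong) (auto simp: z_def)
    ultimately have 1: "((\<lambda>n. n * (H (\<Theta> n u) - H p)) \<longlongrightarrow> - (\<Sum>i\<in>Z. lam i * u i) + Q (w u)) at_top"
      by simp
    have "((\<lambda>n. (\<Prod>i\<in>Z. u i powr (\<alpha> i - 1)) * (\<Prod>i\<in>-Z. \<Theta> n u $ i powr (\<alpha> i - 1)) *
      exp (n * (H (\<Theta> n u) - H p))) \<longlongrightarrow> (\<Prod>i\<in>Z. u i powr (\<alpha> i - 1)) * (\<Prod>i\<in>-Z. p $ i powr (\<alpha> i - 1)) *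
      exp (- (\<Sum>i\<in>Z. lam i * u i) + Q (w u))) at_top"
      by (intro tendsto_mult tendsto_const tendsto_prod tendsto_exp 1 tendsto_powr
          tendsto_vec_nth \<Theta>_lim) (auto dest: ppos)
    moreover have "(\<Prod>i\<in>Z. u i powr (\<alpha> i - 1)) = (\<Prod>i\<in>Z. indicator {0..} (u i) * u i powr (\<alpha> i - 1))"
      using True by (intro prod.cong) auto
    ultimately show ?thesis
      unfolding L_def using Lim_transform_eventually[OF _ ev] by simp
  qed
  have w_meas [measurable]: "w \<in> borel_measurable (free_lebesgue k)"
    unfolding w_def[abs_def]
  proof (rule borel_measurable_vec_lambda)
    fix i show "(\<lambda>u. if i = k then - (\<Sum>j\<in>F. u j) else if i \<in> Z then 0 else u i) \<in> borel_measurable (free_lebesgue k)"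
      using cZ by (cases "i = k"; cases "i \<in> Z") (auto intro!: borel_measurable_uminus borel_measurable_sum
          measurable_free_lebesgue_component)
  qed
  have L_meas [measurable]: "L \<in> borel_measurable (free_lebesgue k)"
  proof -
    note Q [measurable]
    have [measurable]: "(\<lambda>u. u i) \<in> borel_measurable (free_lebesgue k)" if "i \<in> Z" for i
      using that kZ by (intro measurable_free_lebesgue_component) auto
    show ?thesis unfolding L_def[abs_def] by measurable
  qed
  have S_meas: "S n \<in> borel_measurable (free_lebesgue k)" for n
    unfolding S_def[abs_def] by measurable
  have conv: "((\<lambda>n. \<integral>u. S n u \<partial>free_lebesgue k) \<longlongrightarrow> (\<integral>u. L u \<partial>free_lebesgue k)) at_top"
  proof (rule integral_dominated_convergence_at_top[OF L_meas S_meas W_int])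
    show "\<forall>\<^sub>F n in at_top. AE u in free_lebesgue k. norm (S n u) \<le> W u"
      using eventually_gt_at_top[of 0] by eventually_elim (auto simp: S_nonneg S_le_W)
    show "AE u in free_lebesgue k. ((\<lambda>n. S n u) \<longlongrightarrow> L u) at_top"
      using S_lim by simp
  qed
  have L_nonneg: "L u \<ge> 0" for u
    by (auto simp: L_def intro!: mult_nonneg_nonneg prod_nonneg)
  have L_le: "L u \<le> W u" for u
    by (rule tendsto_upperbound[OF S_lim eventually_mono[OF eventually_gt_at_top[of 0] S_le_W]]) auto
  have L_int: "integrable (free_lebesgue k) L"
    by (rule Bochner_Integration.integrable_bound[OF W_int L_meas])
       (use L_le L_nonneg in \<open>auto intro!: AE_I2 order_trans[OF _ abs_ge_self]\<close>)
  have "(\<integral>u. L u \<partial>free_lebesgue k) \<noteq> 0"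
  proof
    assume "(\<integral>u. L u \<partial>free_lebesgue k) = 0"
    hence AE0: "AE u in free_lebesgue k. L u = 0"
      using integral_nonneg_eq_0_iff_AE[OF L_int] L_nonneg by simp
    \<comment> \<open>\<open>L\<close> is strictly positive on this open cube, which has measure 1,
      so \<open>L\<close> cannot vanish almost everywhere.\<close>
    define E where "E = Pi\<^sub>E (-{k}) (\<lambda>_. {0<..<1::real})"
    have "AE u in free_lebesgue k. u \<notin> E"
      using AE0
    proof eventually_elim
      case (elim u)
      show ?case
      proof
        assume "u \<in> E"
        have 1: "0 < indicator {0..} (u i) * u i powr (\<alpha> i - 1)" if "i \<in> Z" for i
        proof -
          have "i \<in> - {k}" using that kZ by auto
          hence "u i > 0" using \<open>u \<in> E\<close> by (auto simp: E_def PiE_iff)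
          thus ?thesis by simp
        qed
        have 2: "0 < p $ i powr (\<alpha> i - 1)" if "i \<in> - Z" for i
          using that ppos[of i] by simp
        have "0 < L u"
          unfolding L_def
          by (rule mult_pos_pos[OF mult_pos_pos[OF prod_pos[OF 1] prod_pos[OF 2]] exp_gt_zero])
        thus False using elim by simp
      qed
    qed
    moreover have E_sets: "E \<in> sets (free_lebesgue k)"
      unfolding E_def free_lebesgue_def by (intro sets_PiM_I_finite) auto
    ultimately have "emeasure (free_lebesgue k) E = 0"
      by (subst (asm) AE_iff_measurable[OF E_sets]) (use sets.sets_into_space[OF E_sets] in auto)
    moreover have "emeasure (free_lebesgue k) E = 1"
      unfolding E_def free_lebesgue_def by (subst emeasure_PiM) auto
    ultimately show False by simp
  qed
  moreover have "(\<integral>u. L u \<partial>free_lebesgue k) \<ge> 0"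
    by (intro integral_nonneg_AE) (simp add: L_nonneg)
  ultimately have pos: "(\<integral>u. L u \<partial>free_lebesgue k) > 0" by simp

  define q where "q = (real CARD('k) - 1 - real (card Z)) / 2 + (\<Sum>i\<in>Z. \<alpha> i)"
  have "\<forall>\<^sub>F n in at_top. (\<integral>u. S n u \<partial>free_lebesgue k) =
      n powr q * (\<integral>x. near \<alpha> p \<delta> n (lift_simplex k x) \<partial>free_lebesgue k)"
    using eventually_gt_at_top[of 0]
  proof eventually_elim
    case (elim n)
    have "(\<integral>x. near \<alpha> p \<delta> n (lift_simplex k x) \<partial>free_lebesgue k) =
        (\<Prod>i\<in>-{k}. s n i) * (\<integral>u. near \<alpha> p \<delta> n (\<Theta> n u) \<partial>free_lebesgue k)"
      unfolding \<Theta>_def free_lebesgue_def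
    proof (rule integral_PiM_lborel_affine)
      show "(\<lambda>x. near \<alpha> p \<delta> n (lift_simplex k x)) \<in> borel_measurable (Pi\<^sub>M (- {k}) (\<lambda>_. lborel))"
        using measurable_compose[OF measurable_lift_simplex near_meas] by (simp add: free_lebesgue_def)
    qed (use elim in \<open>auto simp: s_def near_nonneg\<close>)
    \<comment> \<open>With m the size of \<open>Z\<close>, the Jacobian is \<open>n\<close> to the
      power -m - card F / 2. The second term cancels the Gaussian half of \<open>q\<close>; the
      first turns the sum of \<open>\<alpha> i\<close> into the sum of
      \<open>\<alpha> i - 1\<close>, the power built into \<open>S\<close>.\<close>
    moreover have "n powr q * (\<Prod>i\<in>-{k}. s n i) = n powr (\<Sum>i\<in>Z. \<alpha> i - 1)"
    proof -
      have "(\<Prod>i\<in>Z. s n i) = (\<Prod>i\<in>Z. n powr (-1))"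
        using elim by (intro prod.cong) (auto simp: s_def powr_minus_divide)
      also have "\<dots> = n powr (\<Sum>i\<in>Z. -1)"
        using elim by (intro powr_sum[symmetric]) auto
      finally have 1: "(\<Prod>i\<in>Z. s n i) = n powr (- real (card Z))" by simp
      have "(\<Prod>i\<in>F. s n i) = (\<Prod>i\<in>F. n powr (-1/2))"
        using elim by (intro prod.cong) (auto simp: s_def F_def powr_minus_divide powr_half_sqrt)
      also have "\<dots> = n powr (\<Sum>i\<in>F. -1/2)"
        using elim by (intro powr_sum[symmetric]) auto
      finally have 2: "(\<Prod>i\<in>F. s n i) = n powr (- real (card F) / 2)" by simp
      show ?thesis
        unfolding prodJ 1 2 powr_add[symmetric] q_def cardF[symmetric] by (simp add: sum_subtractf)
    qed
    ultimately show ?case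
      by (simp add: S_def mult.assoc[symmetric])
  qed
  hence "((\<lambda>n. n powr q * (\<integral>x. near \<alpha> p \<delta> n (lift_simplex k x) \<partial>free_lebesgue k)) \<longlongrightarrow>
      (\<integral>u. L u \<partial>free_lebesgue k)) at_top"
    by (rule Lim_transform_eventually[OF conv])
  thus ?thesis using pos unfolding q_def by blast
qed

section \<open>Combining the near and far contributions\<close>

theorem theorem1:
  fixes H :: "real ^ 'k \<Rightarrow> real"
    and \<theta>s :: "real ^ 'k"
    and \<alpha> :: "'k \<Rightarrow> real"
    and k0 :: 'k
  assumes K2: "CARD('k) \<ge> 2"
    and alpha_pos: "\<forall>i. 0 < \<alpha> i"
    and A1: "\<theta>s \<in> prob_simplex" "\<forall>\<theta>\<in>prob_simplex. \<theta> \<noteq> \<theta>s \<longrightarrow> H \<theta> < H \<theta>s"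
    and A2: "continuous_on prob_simplex H"
      "\<exists>U G Hs. open U \<and> \<theta>s \<in> U \<and> C2_on_with U H G Hs \<and>
         (\<exists>lam mu. (\<forall>i\<in>{i. \<theta>s $ i = 0}. 0 < lam i) \<and>
            G \<theta>s = (\<chi> j. mu) - (\<Sum>i\<in>{i. \<theta>s $ i = 0}. lam i *\<^sub>R axis i 1)) \<and>
         (\<forall>d::real ^ 'k. d \<noteq> 0 \<and> (\<Sum>i\<in>UNIV. d $ i) = 0 \<and>
            (\<forall>i\<in>{i. \<theta>s $ i = 0}. d $ i = 0) \<longrightarrow> d \<bullet> (Hs \<theta>s *v d) < 0)"
  shows "\<exists>C>0. (\<lambda>n::real. dirichlet_expectation \<alpha> k0 (\<lambda>\<theta>. exp (n * H \<theta>)))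
           \<sim>[at_top] (\<lambda>n. C * exp (n * H \<theta>s)
              * n powr (- (real CARD('k) - 1 - real (card {i. \<theta>s $ i = 0})) / 2)
              * n powr (- (\<Sum>i\<in>{i. \<theta>s $ i = 0}. \<alpha> i)))"
proof -
  define Z where "Z = {i. \<theta>s $ i = 0}"
  from A2(2) obtain U G Hs lam mu where U: "open U" "\<theta>s \<in> U" and C2: "C2_on_with U H G Hs"
    and lam: "\<forall>i\<in>Z. 0 < lam i"
    and G: "G \<theta>s = (\<chi> j. mu) - (\<Sum>i\<in>Z. lam i *\<^sub>R axis i 1)"
    and neg': "\<forall>d::real ^ 'k. d \<noteq> 0 \<and> (\<Sum>i\<in>UNIV. d $ i) = 0 \<and> (\<forall>i\<in>Z. d $ i = 0) \<longrightarrow>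
      d \<bullet> (Hs \<theta>s *v d) < 0"
    unfolding Z_def[symmetric] by (elim exE conjE)
  have neg: "(Hs \<theta>s *v d) \<bullet> d < 0"
    if "d \<noteq> 0" "(\<Sum>i\<in>UNIV. d $ i) = 0" "\<And>i. i \<in> Z \<Longrightarrow> d $ i = 0" for d
    using that neg' by (simp add: inner_commute)
  have dH: "\<And>y. y \<in> U \<Longrightarrow> (H has_derivative (\<lambda>h. G y \<bullet> h)) (at y)"
    and dG: "(G has_derivative (\<lambda>h. Hs \<theta>s *v h)) (at \<theta>s)"
    using C2 U by (auto simp: C2_on_with_def)
  obtain c \<delta>0 where c: "c > 0" and \<delta>0: "\<delta>0 > 0" and growth0:
    "\<And>d. norm d < \<delta>0 \<Longrightarrow> (\<Sum>i\<in>UNIV. d $ i) = 0 \<Longrightarrow> (\<forall>i\<in>Z. 0 \<le> d $ i) \<Longrightarrow>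
      H (\<theta>s + d) - H \<theta>s \<le> - c * ((\<Sum>i\<in>Z. d $ i) + (\<Sum>i\<in>-Z. (d $ i)\<^sup>2))"
    using local_growth[OF U dH dG _ G neg] lam by blast
  have pos: "\<theta>s $ i > 0" if "i \<notin> Z" for i
    using that A1(1) by (auto simp: Z_def prob_simplex_def less_le)
  \<comment> \<open>One radius for both purposes: the growth bound holds in the ball, and
    coordinates outside \<open>Z\<close> keep at least half their value at the maximiser.\<close>
  define \<delta> where "\<delta> = Min (insert \<delta>0 ((\<lambda>i. \<theta>s $ i / 2) ` (-Z)))"
  have \<delta>: "\<delta> > 0" "\<delta> \<le> \<delta>0"
    using \<delta>0 pos by (auto simp: \<delta>_def)
  have \<delta>_half: "\<delta> \<le> \<theta>s $ i / 2" if "i \<notin> Z" for i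
    unfolding \<delta>_def using that by (intro Min_le) auto
  obtain k where k: "\<theta>s $ k \<noteq> 0"
  proof -
    have "(\<Sum>i\<in>UNIV. \<theta>s $ i) \<noteq> 0" using A1(1) by (simp add: prob_simplex_def)
    thus ?thesis using that by (meson sum.neutral)
  qed
  have growth: "H \<theta> - H \<theta>s \<le> - c * ((\<Sum>i\<in>Z. \<theta> $ i) + (\<Sum>i\<in>-Z. (\<theta> $ i - \<theta>s $ i)\<^sup>2))"
    if "\<theta> \<in> prob_simplex" "\<theta> \<in> ball \<theta>s \<delta>" for \<theta>
  proof -
    have "norm (\<theta> - \<theta>s) < \<delta>0" using that \<delta> by (simp add: dist_norm norm_minus_commute)
    moreover have "(\<Sum>i\<in>UNIV. (\<theta> - \<theta>s) $ i) = 0"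
      using that A1(1) by (simp add: sum_subtractf prob_simplex_def)
    moreover have eqZ: "(\<theta> - \<theta>s) $ i = \<theta> $ i" if "i \<in> Z" for i
      using that by (simp add: Z_def)
    moreover have "\<forall>i\<in>Z. 0 \<le> (\<theta> - \<theta>s) $ i"
      using that eqZ by (auto simp: prob_simplex_def)
    ultimately show ?thesis using growth0[of "\<theta> - \<theta>s"] by simp
  qed
  define Q where "Q w = ((Hs \<theta>s *v w) \<bullet> w) / 2" for w
  have Q: "Q \<in> borel_measurable borel"
    unfolding Q_def[abs_def]
    by (intro borel_measurable_continuous_onI continuous_intros linear_continuous_on
        matrix_vector_mul_bounded_linear) simp
  have lim: "((\<lambda>n. n * (H (\<theta>s + (w /\<^sub>R sqrt n + z /\<^sub>R n)) - H \<theta>s)) \<longlongrightarrow> - (\<Sum>i\<in>Z. lam i * z $ i) + Q w) at_top"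
    if "(\<Sum>i\<in>UNIV. w $ i) = 0" "\<And>i. i \<in> Z \<Longrightarrow> w $ i = 0" "(\<Sum>i\<in>UNIV. z $ i) = 0" for w z
  proof -
    have "G \<theta>s \<bullet> w = 0" unfolding G KKT_gradient_inner[OF that(1)] using that(2) by simp
    from scaled_second_order_limit[OF U dH dG this, of z] show ?thesis
      by (simp only: Q_def G KKT_gradient_inner[OF that(3)])
  qed
  define q where "q = (real CARD('k) - 1 - real (card Z)) / 2 + (\<Sum>i\<in>Z. \<alpha> i)"
  define f where "f A n x = dirichlet_kernel \<alpha> (lift_simplex k x) * indicator A (lift_simplex k x) *
    exp (n * (H (lift_simplex k x) - H \<theta>s))" for A n x
  obtain C where C: "C > 0"
    and near: "((\<lambda>n. n powr q * (\<integral>x. f (ball \<theta>s \<delta>) n x \<partial>free_lebesgue k)) \<longlongrightarrow> C) at_top"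
    using near_part_limit[OF _ A1(1) Z_def k A2(1) c \<delta>(1) \<delta>_half growth Q lim, of \<alpha>] alpha_pos
    unfolding q_def f_def by blast
  have far: "((\<lambda>n. n powr q * (\<integral>x. f (- ball \<theta>s \<delta>) n x \<partial>free_lebesgue k)) \<longlongrightarrow> 0) at_top"
    unfolding f_def using alpha_pos A1(2) by (intro far_part_limit A2(1) \<delta>(1)) auto
  \<comment> \<open>For positive \<open>n\<close> the exponential is at most 1 on the simplex, so
    the kernel is a majorant. Integrability justifies splitting the integral into ball and
    complement.\<close>
  have f_int: "integrable (free_lebesgue k) (f A n)" if "A \<in> sets borel" "n > 0" for A n
  proof (rule Bochner_Integration.integrable_bound)
    show "integrable (free_lebesgue k) (\<lambda>x. dirichlet_kernel \<alpha> (lift_simplex k x))"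
      using alpha_pos by (intro integrable_dirichlet_kernel) auto
    show "f A n \<in> borel_measurable (free_lebesgue k)"
      unfolding f_def[abs_def]
      by (rule measurable_compose[OF measurable_lift_simplex weighted_kernel_measurable[OF A2(1) that(1)]])
    have "f A n x \<le> dirichlet_kernel \<alpha> (lift_simplex k x)" for x
    proof (cases "lift_simplex k x \<in> prob_simplex")
      case True
      hence "n * (H (lift_simplex k x) - H \<theta>s) \<le> 0"
        using A1(2) \<open>n > 0\<close> by (cases "lift_simplex k x = \<theta>s") (auto simp: mult_le_0_iff less_imp_le)
      thus ?thesis
        unfolding f_def mult.assoc
        by (intro mult_left_le dirichlet_kernel_nonneg mult_le_one) auto
    qed (simp add: f_def dirichlet_kernel_def)
    thus "AE x in free_lebesgue k. norm (f A n x) \<le> norm (dirichlet_kernel \<alpha> (lift_simplex k x))"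
      by (simp add: f_def dirichlet_kernel_nonneg)
  qed
  define B where "B = multi_beta \<alpha>"
  have B: "B > 0"
    using alpha_pos unfolding B_def multi_beta_def
    by (intro divide_pos_pos prod_pos Gamma_real_pos sum_pos) auto
  have expect: "dirichlet_expectation \<alpha> k0 (\<lambda>\<theta>. exp (n * H \<theta>)) = exp (n * H \<theta>s) / B *
      ((\<integral>x. f (ball \<theta>s \<delta>) n x \<partial>free_lebesgue k) + (\<integral>x. f (- ball \<theta>s \<delta>) n x \<partial>free_lebesgue k))"
    if n: "n > 0" for n
  proof -
    have "(\<lambda>\<theta>. indicator prob_simplex \<theta> *\<^sub>R exp (n * H \<theta>)) \<in> borel_measurable borel"
      by (intro borel_measurable_continuous_on_indicator sets_prob_simplex continuous_intros A2(1))
    hence "dirichlet_expectation \<alpha> k0 (\<lambda>\<theta>. exp (n * H \<theta>)) =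
        (\<integral>x. exp (n * H (lift_simplex k x)) * dirichlet_kernel \<alpha> (lift_simplex k x) \<partial>free_lebesgue k) / B"
      unfolding B_def by (intro dirichlet_expectation_eq) auto
    also have "(\<integral>x. exp (n * H (lift_simplex k x)) * dirichlet_kernel \<alpha> (lift_simplex k x) \<partial>free_lebesgue k) =
        (\<integral>x. exp (n * H \<theta>s) * (f (ball \<theta>s \<delta>) n x + f (- ball \<theta>s \<delta>) n x) \<partial>free_lebesgue k)"
      by (intro Bochner_Integration.integral_cong refl)
         (auto simp: f_def indicator_def exp_diff right_diff_distrib)
    also have "\<dots> = exp (n * H \<theta>s) * ((\<integral>x. f (ball \<theta>s \<delta>) n x \<partial>free_lebesgue k) +
        (\<integral>x. f (- ball \<theta>s \<delta>) n x \<partial>free_lebesgue k))"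
      using f_int[OF _ n] by (simp add: Bochner_Integration.integral_add)
    finally show ?thesis by simp
  qed
  have main: "((\<lambda>n. (n powr q * (\<integral>x. f (ball \<theta>s \<delta>) n x \<partial>free_lebesgue k) +
      n powr q * (\<integral>x. f (- ball \<theta>s \<delta>) n x \<partial>free_lebesgue k)) / C) \<longlongrightarrow> (C + 0) / C) at_top"
    by (intro tendsto_divide tendsto_add near far tendsto_const) (use C in simp)
  show ?thesis
    unfolding Z_def[symmetric]
  proof (intro exI[of _ "C / B"] conjI asymp_equivI')
    \<comment> \<open>\<open>C\<close> is the limit for the unnormalised kernel with the peak value
      \<open>exp (n * H \<theta>s)\<close> factored out; dividing by \<open>B\<close> restores the
      normalisation of the Dirichlet density.\<close>
    show "C / B > 0" using B C by simp
    show "((\<lambda>n. dirichlet_expectation \<alpha> k0 (\<lambda>\<theta>. exp (n * H \<theta>)) / (C / B * exp (n * H \<theta>s) *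
        n powr (- (real CARD('k) - 1 - real (card Z)) / 2) * n powr (- (\<Sum>i\<in>Z. \<alpha> i)))) \<longlongrightarrow> 1) at_top"
    proof (rule Lim_transform_eventually)
      show "((\<lambda>n. (n powr q * (\<integral>x. f (ball \<theta>s \<delta>) n x \<partial>free_lebesgue k) +
          n powr q * (\<integral>x. f (- ball \<theta>s \<delta>) n x \<partial>free_lebesgue k)) / C) \<longlongrightarrow> 1) at_top"
        using main C by simp
      show "\<forall>\<^sub>F n in at_top. (n powr q * (\<integral>x. f (ball \<theta>s \<delta>) n x \<partial>free_lebesgue k) +
          n powr q * (\<integral>x. f (- ball \<theta>s \<delta>) n x \<partial>free_lebesgue k)) / C =
        dirichlet_expectation \<alpha> k0 (\<lambda>\<theta>. exp (n * H \<theta>)) / (C / B * exp (n * H \<theta>s) *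
          n powr (- (real CARD('k) - 1 - real (card Z)) / 2) * n powr (- (\<Sum>i\<in>Z. \<alpha> i)))"
        using eventually_gt_at_top[of 0]
      proof eventually_elim
        case (elim n)
        have "n powr (- (real CARD('k) - 1 - real (card Z)) / 2) * n powr (- (\<Sum>i\<in>Z. \<alpha> i)) = n powr (- q)"
          unfolding powr_add[symmetric] q_def by (rule arg_cong[where f = "(powr) n"]) (simp add: field_simps)
        also have "\<dots> = 1 / n powr q" by (rule powr_minus_divide)
        finally have eq: "C / B * exp (n * H \<theta>s) * n powr (- (real CARD('k) - 1 - real (card Z)) / 2) *
            n powr (- (\<Sum>i\<in>Z. \<alpha> i)) = C / B * exp (n * H \<theta>s) / n powr q"
          by (simp only: mult.assoc times_divide_eq_right mult_1_right)
        show ?case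
          unfolding eq using elim B C by (simp add: expect field_simps)
      qed
    qed
  qed
qed

end
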